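(* Let $L$ be a $c$-step nilpotent Lie superalgebra over $\mathbb{F}$ with $\dim L=(m\mid n)$ and $\dim(\gamma_2(L))=(r\mid s)$, where $r+s\geq 1$. Then $$\dim(\mathcal{M}(L))\leq \frac{1}{2}\big[(m+n-r-s)(m+n+r+s)+(n-m-r-3s)\big]-\sum_{i=2}^{l}(m+n-r-s-i),$$ where $l=\min\{c,\,m+n-r-s\}$.
   Context: $\mathbb{F}$ is a field of characteristic different from $2$ and $3$; all vector superspaces and superalgebras are over $\mathbb{F}$. A Lie superalgebra is a $\mathbb{Z}_2$-graded vector space $L=L_{\bar 0}\oplus L_{\bar 1}$ with a bilinear bracket satisfying $[L_\alpha,L_\beta]\subset L_{\alpha+\beta}$, graded skew-symmetry $[x,y]=-(-1)^{|x||y|}[y,x]$, and the graded Jacobi identity $(-1)^{|x||z|}[x,[y,z]]+(-1)^{|y||x|}[y,[z,x]]+(-1)^{|z||y|}[z,[x,y]]=0$ for homogeneous $x,y,z$, where $|x|\in\mathbb{Z}_2$ denotes the degree of $x$. $\dim L=(m\mid n)$ means $\dim L_{\bar 0}=m$ and $\dim L_{\bar 1}=n$ (both finite). In the inequality, $\dim(\mathcal{M}(L))$ denotes the total dimension of $\mathcal{M}(L)$ as an $\mathbb{F}$-vector space, i.e. the sum of the dimensions of its even and odd parts. The descending central sequence is $\gamma_1(L)=L^1=L$, $\gamma_{k+1}(L)=L^{k+1}=[L^k,L]$ for $k\ge 1$; in particular $\gamma_2(L)=[L,L]$. $L$ is $c$-step nilpotent if $\gamma_{c+1}(L)=0$ and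 $\gamma_c(L)\neq 0$. The Schur multiplier of $L$ is $\mathcal{M}(L)=(F^2\cap R)/[F,R]$, where $0\to R\to F\to L\to 0$ is a free presentation of $L$, i.e. $F$ is a free Lie superalgebra, $R$ is a graded ideal of $F$, $F/R\cong L$, and $F^2=[F,F]$; up to isomorphism it is independent of the presentation. A sum over an empty range of indices is $0$. *)

theory Defs
  imports
    "HOL-Computational_Algebra.Computational_Algebra"
    "HOL-Library.Poly_Mapping"
    "HOL-Library.Z2"
begin

(* Superspaces and superalgebras are carried by subspaces of an ambient vector space:
   the type 'v may be larger than the superspace itself, which is "whole V" below.
   The type bit plays the role of Z_2, so that addition of degrees is addition modulo 2. *)

record ('k, 'v) superspace =
  scl :: "'k \<Rightarrow> 'v \<Rightarrow> 'v"
  part :: "bit \<Rightarrow> 'v set"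

record ('k, 'v) superalgebra = "('k, 'v) superspace" +
  brk :: "'v \<Rightarrow> 'v \<Rightarrow> 'v"

definition whole :: "('k, 'v::ab_group_add, 'z) superspace_scheme \<Rightarrow> 'v set" where
  "whole V = {x + y | x y. x \<in> part V 0 \<and> y \<in> part V 1}"

definition is_superspace :: "('k::field, 'v::ab_group_add, 'z) superspace_scheme \<Rightarrow> bool" where
  "is_superspace V \<longleftrightarrow>
     vector_space (scl V) \<and>
     (\<forall>a. module.subspace (scl V) (part V a)) \<and>
     part V 0 \<inter> part V 1 = {0}"

(* A subspace W is meant to be contained in whole V and graded, so that it is the direct sum
   of its intersections with the two parts. The first conjunct is needed because the library's
   dim of an infinite-dimensional space is 0. *)
definition has_sdim ::
    "('k::field, 'v::ab_group_add, 'z) superspace_scheme \<Rightarrow> 'v set \<Rightarrow> nat \<Rightarrow> nat \<Rightarrow> bool" where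
  "has_sdim V W m n \<longleftrightarrow>
     (\<exists>B. finite B \<and> W \<subseteq> module.span (scl V) B) \<and>
     vector_space.dim (scl V) (W \<inter> part V 0) = m \<and>
     vector_space.dim (scl V) (W \<inter> part V 1) = n"

(* (-1)^(ab) *)
definition koszul :: "bit \<Rightarrow> bit \<Rightarrow> 'k::field" where
  "koszul a b = (if a * b = 1 then - 1 else 1)"

definition lie_superalgebra :: "('k::field, 'v::ab_group_add) superalgebra \<Rightarrow> bool" where
  "lie_superalgebra L \<longleftrightarrow>
     is_superspace L \<and>
     (\<forall>x\<in>whole L. \<forall>y\<in>whole L. \<forall>z\<in>whole L.
        brk L (x + y) z = brk L x z + brk L y z \<and>
        brk L z (x + y) = brk L z x + brk L z y) \<and>
     (\<forall>t. \<forall>x\<in>whole L. \<forall>y\<in>whole L.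
        brk L (scl L t x) y = scl L t (brk L x y) \<and>
        brk L x (scl L t y) = scl L t (brk L x y)) \<and>
     (\<forall>a b. \<forall>x\<in>part L a. \<forall>y\<in>part L b. brk L x y \<in> part L (a + b)) \<and>
     (\<forall>a b. \<forall>x\<in>part L a. \<forall>y\<in>part L b.
        brk L x y = - scl L (koszul a b) (brk L y x)) \<and>
     (\<forall>a b c. \<forall>x\<in>part L a. \<forall>y\<in>part L b. \<forall>z\<in>part L c.
        scl L (koszul a c) (brk L x (brk L y z)) +
        scl L (koszul b a) (brk L y (brk L z x)) +
        scl L (koszul c b) (brk L z (brk L x y)) = 0)"

definition commutator ::
    "('k::field, 'v::ab_group_add) superalgebra \<Rightarrow> 'v set \<Rightarrow> 'v set \<Rightarrow> 'v set" where
  "commutator L A B = module.span (scl L) {brk L x y | x y. x \<in> A \<and> y \<in> B}"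

(* Indexed from 1; the value at 0 is immaterial. *)
definition lower_central ::
    "('k::field, 'v::ab_group_add) superalgebra \<Rightarrow> nat \<Rightarrow> 'v set" where
  "lower_central L k = ((\<lambda>I. commutator L I (whole L)) ^^ (k - 1)) (whole L)"

definition step_nilpotent :: "('k::field, 'v::ab_group_add) superalgebra \<Rightarrow> nat \<Rightarrow> bool" where
  "step_nilpotent L c \<longleftrightarrow>
     c \<ge> 1 \<and> lower_central L (c + 1) = {0} \<and> lower_central L c \<noteq> {0}"

(* Linear on the subspace W only; values outside W are irrelevant. *)
definition linear_map_on ::
    "('k, 'v::ab_group_add, 'y) superspace_scheme \<Rightarrow> 'v set \<Rightarrow>
     ('k, 'w::ab_group_add, 'z) superspace_scheme \<Rightarrow> ('v \<Rightarrow> 'w) \<Rightarrow> bool" where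
  "linear_map_on V W U f \<longleftrightarrow>
     (\<forall>x\<in>W. \<forall>y\<in>W. f (x + y) = f x + f y) \<and>
     (\<forall>t. \<forall>x\<in>W. f (scl V t x) = scl U t (f x))"

definition super_hom ::
    "('k, 'v::ab_group_add) superalgebra \<Rightarrow> ('k, 'w::ab_group_add) superalgebra \<Rightarrow>
     ('v \<Rightarrow> 'w) \<Rightarrow> bool" where
  "super_hom L M f \<longleftrightarrow>
     linear_map_on L (whole L) M f \<and>
     (\<forall>a. f ` part L a \<subseteq> part M a) \<and>
     (\<forall>x\<in>whole L. \<forall>y\<in>whole L. f (brk L x y) = brk M (f x) (f y))"

(* F is free on the set X of homogeneous elements, by the universal property. HOL cannot quantify
   over all types of target algebras, so the targets are those carried by subspaces of the
   vector space with basis 'f list. This is no restriction: up to isomorphism these include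
   every subalgebra generated by (the image of) X, since such an algebra is spanned by the
   nonassociative words in X, of which there are at most as many as there are lists over 'f;
   and they include F itself, whose dimension is at most the cardinality of 'f. *)
definition free_on ::
    "('k::field, 'f::ab_group_add) superalgebra \<Rightarrow> 'f set \<Rightarrow> bool" where
  "free_on F X \<longleftrightarrow>
     X \<subseteq> part F 0 \<union> part F 1 \<and> 0 \<notin> X \<and>
     (\<forall>(M :: ('k, 'f list \<Rightarrow>\<^sub>0 'k) superalgebra) j.
        lie_superalgebra M \<and> (\<forall>a. j ` (X \<inter> part F a) \<subseteq> part M a) \<longrightarrow>
        (\<exists>h. super_hom F M h \<and> (\<forall>x\<in>X. h x = j x) \<and>
             (\<forall>h'. super_hom F M h' \<and> (\<forall>x\<in>X. h' x = j x) \<longrightarrow>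
                   (\<forall>y\<in>whole F. h' y = h y))))"

definition free_presentation ::
    "('k::field, 'v::ab_group_add) superalgebra \<Rightarrow> ('k, 'f::ab_group_add) superalgebra \<Rightarrow>
     'f set \<Rightarrow> bool" where
  "free_presentation L F R \<longleftrightarrow>
     lie_superalgebra F \<and> (\<exists>X. free_on F X) \<and>
     (\<exists>p. super_hom F L p \<and> p ` whole F = whole L \<and> R = {x \<in> whole F. p x = 0})"

(* M is the quotient superspace (F^2 \<inter> R) / [F, R], given by its quotient map q. *)
definition schur_multiplier ::
    "('k::field, 'f::ab_group_add) superalgebra \<Rightarrow> 'f set \<Rightarrow>
     ('k, 'm::ab_group_add) superspace \<Rightarrow> bool" where
  "schur_multiplier F R M \<longleftrightarrow>
     is_superspace M \<and>
     (let W = commutator F (whole F) (whole F) \<inter> R in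
        \<exists>q. linear_map_on F W M q \<and>
            (\<forall>a. q ` (W \<inter> part F a) \<subseteq> part M a) \<and>
            q ` W = whole M \<and>
            {x \<in> W. q x = 0} = commutator F (whole F) R)"

end

theory Submission
  imports Defs
begin

text \<open>
  Put \<open>K = [F, R]\<close> and \<open>d = dim (L / L\<^sup>2)\<close>. A basis of
  \<open>(F\<^sup>2 \<inter> R) / K\<close> together with lifts of a basis of \<open>L\<^sup>2\<close> is independent in \<open>F\<^sup>2 / K\<close>, so
  \<open>dim M(L) + dim L\<^sup>2\<close> is at most the number of elements spanning \<open>F\<^sup>2\<close> modulo \<open>K\<close>. Such elements
  are found along the lower central series. Let \<open>X\<close> lift a homogeneous basis of \<open>L / L\<^sup>2\<close>.
  Modulo \<open>F\<^sup>3 + K\<close>, \<open>F\<^sup>2\<close> is spanned by the brackets of unordered pairs of distinct elements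
  of \<open>X\<close> and the squares of its odd elements. Modulo \<open>F\<^bsup>i+2\<^esup> + K\<close>, \<open>F\<^bsup>i+1\<^esup>\<close> is spanned by the
  \<open>[y, x]\<close> with \<open>x \<in> X\<close> and \<open>y \<in> Y\<close>, where \<open>Y\<close> consists of left-normed brackets of elements of \<open>X\<close>
  and lifts a basis of \<open>L\<^sup>i / L\<^bsup>i+1\<^esup>\<close>. If \<open>u = [x\<^sub>1, \<dots>, x\<^sub>i]\<close> is one member of \<open>Y\<close>, the Jacobi
  identity puts \<open>[u, z]\<close> into \<open>[F\<^sup>i, x\<^sub>1] + \<dots> + [F\<^sup>i, x\<^sub>i]\<close> for every \<open>z\<close>, so at least \<open>d - i\<close> of these
  generators are superfluous. The series stops because \<open>F\<^bsup>c+1\<^esup> \<subseteq> R\<close> and hence \<open>F\<^bsup>c+2\<^esup> \<subseteq> K\<close>.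
\<close>

section \<open>Linear algebra modulo a subspace\<close>

context vector_space
begin

text \<open>This is the dimension count in the quotient by \<open>K\<close>, carried out in the
  ambient space: a linear \<open>g\<close> with kernel \<open>K\<close> turns independence modulo
  \<open>K\<close> into plain independence. Since the family is indexed, distinctness of its members
  modulo \<open>K\<close> is derived and not assumed.\<close>

lemma card_le_of_independent_mod:
  assumes K: "subspace K" and S: "finite S" and I: "finite I"
    and f: "\<And>i. i \<in> I \<Longrightarrow> f i \<in> span (S \<union> K)"
    and ind: "\<And>c. (\<Sum>i\<in>I. scale (c i) (f i)) \<in> K \<Longrightarrow> \<forall>i\<in>I. c i = 0"
  shows "card I \<le> card S"
proof -
  interpret P: vector_space_pair scale scale ..
  obtain B where B: "B \<subseteq> K" "independent B" "K \<subseteq> span B"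
    using maximal_independent_subset[of K] by blast
  obtain B' where B': "B \<subseteq> B'" "independent B'" "UNIV \<subseteq> span B'"
    using maximal_independent_subset_extend[of B UNIV] B by auto
  \<comment> \<open>\<open>g\<close> kills the basis \<open>B\<close> of \<open>K\<close> and fixes
    the other vectors of \<open>B'\<close>, so it is the projection along \<open>K\<close> onto a
    complement.\<close>
  define g where "g = P.construct B' (\<lambda>b. if b \<in> B then 0 else b)"
  have lin: "Vector_Spaces.linear scale scale g"
    unfolding g_def by (rule P.linear_construct[OF B'(2)])
  interpret g: Vector_Spaces.linear scale scale g by (rule lin)
  have gb: "g b = (if b \<in> B then 0 else b)" if "b \<in> B'" for b
    unfolding g_def by (rule P.construct_basis[OF B'(2) that])
  have diff: "x - g x \<in> K" for x
  proof -
    have "x \<in> span B'" using B'(3) by auto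
    then show ?thesis
    proof (induction rule: span_induct_alt)
      case base
      show ?case using K by (simp add: g.zero subspace_0)
    next
      case (step c x y)
      have "x - g x \<in> K" using gb[OF step(1)] B(1) K by (auto simp: subspace_0)
      then have "scale c (x - g x) + (y - g y) \<in> K"
        using step(2) K by (simp add: subspace_add subspace_scale)
      then show ?case by (simp add: g.add g.scale algebra_simps)
    qed
  qed
  have gK: "g x = 0" if "x \<in> K" for x
  proof -
    have "x \<in> span B" using that B(3) by auto
    then show ?thesis
    proof (induction rule: span_induct_alt)
      case (step c x y)
      then show ?case using gb[of x] B'(1) by (auto simp: g.add g.scale)
    qed (simp add: g.zero)
  qed
  have gK': "x \<in> K" if "g x = 0" for x using diff[of x] that by simp
  have gf: "g (f i) \<in> span (g ` S)" if "i \<in> I" for i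
  proof -
    have "g (f i) \<in> g ` span (S \<union> K)" using f[OF that] by auto
    also have "\<dots> = span (g ` (S \<union> K))" using P.linear_span_image[OF lin] by simp
    also have "\<dots> \<subseteq> span (g ` S)"
      by (rule span_minimal) (auto simp: gK span_zero intro: span_base)
    finally show ?thesis .
  qed
  have inj: "inj_on (\<lambda>i. g (f i)) I"
  proof (rule inj_onI, rule ccontr)
    fix i j assume ij: "i \<in> I" "j \<in> I" "g (f i) = g (f j)" "i \<noteq> j"
    \<comment> \<open>Two indices with the same image would give a relation modulo \<open>K\<close>
      with coefficients 1 and -1.\<close>
    define c where "c k = (if k = i then 1 else if k = j then - 1 else 0 :: 'a)" for k
    have "(\<Sum>k\<in>I. scale (c k) (f k)) = (\<Sum>k\<in>{i,j}. scale (c k) (f k))"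
      by (rule sum.mono_neutral_right) (use ij I in \<open>auto simp: c_def\<close>)
    also have "\<dots> = f i - f j" using ij(4) by (auto simp: c_def)
    also have "\<dots> \<in> K" by (rule gK') (use ij in \<open>simp add: g.diff\<close>)
    finally show False using ind[of c] ij by (auto simp: c_def)
  qed
  have "independent ((\<lambda>i. g (f i)) ` I)"
  proof (rule independent_if_scalars_zero)
    fix c x assume s: "(\<Sum>x\<in>(\<lambda>i. g (f i)) ` I. scale (c x) x) = 0"
      and x: "x \<in> (\<lambda>i. g (f i)) ` I"
    have "g (\<Sum>i\<in>I. scale (c (g (f i))) (f i)) = 0"
      using s by (simp add: sum.reindex[OF inj] g.sum g.scale)
    from ind[OF gK'[OF this]] x show "c x = 0" by auto
  qed (use I in auto)
  then have "card ((\<lambda>i. g (f i)) ` I) \<le> card (g ` S)"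
    using independent_span_bound[of "g ` S" "(\<lambda>i. g (f i)) ` I"] S gf by auto
  also have "\<dots> \<le> card S" using S by (rule card_image_le)
  finally show ?thesis using card_image[OF inj] by simp
qed

text \<open>A basis \<open>A\<close> of \<open>U\<close> is extended inside
  \<open>A \<union> W\<close> to one of \<open>V\<close>; the added vectors are a basis of
  \<open>V / U\<close> drawn from \<open>W\<close>. With \<open>W\<close> consisting of homogeneous
  elements or of words, the representatives inherit that shape.\<close>

lemma relative_basis_subset:
  assumes U: "U \<subseteq> V" "subspace U" and W: "W \<subseteq> V" "V \<subseteq> span (W \<union> U)"
    and fin: "finite B" "V \<subseteq> span B"
  obtains C where "C \<subseteq> W" "finite C" "0 \<notin> C" "card C + dim U = dim V" "V \<subseteq> span (C \<union> U)"
proof -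
  obtain A where A: "A \<subseteq> U" "independent A" "U \<subseteq> span A" "card A = dim U"
    using basis_exists[of U] by blast
  obtain A' where A': "A \<subseteq> A'" "A' \<subseteq> A \<union> W" "independent A'" "A \<union> W \<subseteq> span A'"
    using maximal_independent_subset_extend[of A "A \<union> W"] A by auto
  have sub: "A' \<subseteq> V" using A'(2) A(1) U(1) W(1) by auto
  have "U \<subseteq> span A'" using A(3) span_mono[OF A'(1)] by blast
  then have "span (W \<union> U) \<subseteq> span A'"
    using A'(4) by (intro span_minimal) auto
  then have V: "V \<subseteq> span A'" using W(2) by blast
  have card: "card A' = dim V" using sub A'(3) V by (metis basis_card_eq_dim)
  have fA': "finite A'" using independent_span_bound[OF fin(1) A'(3)] sub fin(2) by blast
  show ?thesis
  proof (rule that[of "A' - A"])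
    show "A' - A \<subseteq> W" using A'(2) by auto
    show "finite (A' - A)" using fA' by simp
    show "0 \<notin> A' - A" using A'(3) dependent_zero by blast
    show "card (A' - A) + dim U = dim V"
      using card A(4) A'(1) fA' by (metis card_Diff_subset card_mono finite_subset le_add_diff_inverse2)
    have "span A' \<subseteq> span ((A' - A) \<union> U)" using A(1) by (intro span_mono) auto
    then show "V \<subseteq> span ((A' - A) \<union> U)" using V by auto
  qed
qed

end

section \<open>Maps that are linear on a subspace only\<close>

lemma linear_map_on_sum:
  assumes f: "linear_map_on V W U f" and V: "vector_space (scl V)" and U: "vector_space (scl U)"
    and W: "module.subspace (scl V) W"
    and I: "finite I" "\<And>i. i \<in> I \<Longrightarrow> w i \<in> W"
  shows "(\<Sum>i\<in>I. scl V (c i) (w i)) \<in> W \<and>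
    f (\<Sum>i\<in>I. scl V (c i) (w i)) = (\<Sum>i\<in>I. scl U (c i) (f (w i)))"
proof -
  interpret V: vector_space "scl V" by (rule V)
  interpret U: vector_space "scl U" by (rule U)
  have f0: "f 0 = 0"
    using f V.subspace_0[OF W] unfolding linear_map_on_def
    by (metis U.scale_zero_left V.scale_zero_left)
  show ?thesis using I
  proof (induction I rule: finite_induct)
    case empty
    show ?case using f0 V.subspace_0[OF W] by simp
  next
    case (insert i I)
    then show ?case using f V.subspace_add[OF W] V.subspace_scale[OF W]
      unfolding linear_map_on_def by simp
  qed
qed

lemma linear_map_on_span_image:
  assumes f: "linear_map_on V W U f" and V: "vector_space (scl V)" and U: "vector_space (scl U)"
    and W: "module.subspace (scl V) W" and A: "A \<subseteq> W"
  shows "f ` module.span (scl V) A = module.span (scl U) (f ` A)"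
proof -
  interpret V: vector_space "scl V" by (rule V)
  interpret U: vector_space "scl U" by (rule U)
  have f0: "f 0 = 0"
    using f V.subspace_0[OF W] unfolding linear_map_on_def
    by (metis U.scale_zero_left V.scale_zero_left)
  have fl: "f (scl V c x + y) = scl U c (f x) + f y" if "x \<in> W" "y \<in> W" for c x y
    using that f V.subspace_scale[OF W] unfolding linear_map_on_def by metis
  have sW: "V.span A \<subseteq> W" using A W by (rule V.span_minimal)
  have "f x \<in> U.span (f ` A)" if "x \<in> V.span A" for x
  proof -
    \<comment> \<open>Membership in \<open>W\<close> is carried through the induction because
      \<open>f\<close> is additive only there.\<close>
    from that have "x \<in> W \<and> f x \<in> U.span (f ` A)"
    proof (induction rule: V.span_induct_alt)
      case base
      show ?case using f0 by (simp add: U.span_zero V.subspace_0[OF W])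
    next
      case (step c x y)
      have "x \<in> W" using step A by auto
      with step show ?case
        using fl[of x y c] V.subspace_add[OF W] V.subspace_scale[OF W]
        by (simp add: U.span_add U.span_scale U.span_base)
    qed
    then show ?thesis ..
  qed
  moreover have "y \<in> f ` V.span A" if "y \<in> U.span (f ` A)" for y
    using that
  proof (induction rule: U.span_induct_alt)
    case base
    show ?case by (metis f0 image_eqI V.span_zero)
  next
    case (step c x y)
    then obtain a b where ab: "a \<in> A" "x = f a" "b \<in> V.span A" "y = f b" by blast
    then have "scl U c x + y = f (scl V c a + b)" using fl[of a b c] A sW by (metis subsetD)
    moreover have "scl V c a + b \<in> V.span A"
      using ab by (simp add: V.span_add V.span_scale V.span_base)
    ultimately show ?case by blast
  qed
  ultimately show ?thesis by blast
qed

section \<open>Superspaces and graded subspaces\<close>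

locale super_space =
  fixes F :: "('k::field, 'v::ab_group_add, 'z) superspace_scheme"
  assumes super: "is_superspace F"
begin

sublocale vector_space "scl F"
  using super unfolding is_superspace_def by blast

lemma subspace_part: "subspace (part F a)"
  using super unfolding is_superspace_def by blast

lemma part_disjoint: "part F 0 \<inter> part F 1 = {0}"
  using super unfolding is_superspace_def by blast

lemma part_subset_whole: "part F a \<subseteq> whole F"
proof
  fix x assume x: "x \<in> part F a"
  consider "a = 0" | "a = 1" by (cases a) auto
  then show "x \<in> whole F"
  proof cases
    case 1
    then have "x = x + 0 \<and> x \<in> part F 0 \<and> 0 \<in> part F 1"
      using x subspace_0[OF subspace_part] by simp
    then show ?thesis unfolding whole_def by blast
  next
    case 2
    then have "x = 0 + x \<and> 0 \<in> part F 0 \<and> x \<in> part F 1"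
      using x subspace_0[OF subspace_part] by simp
    then show ?thesis unfolding whole_def by blast
  qed
qed

lemma whole_eq_span: "whole F = span (part F 0 \<union> part F 1)"
  unfolding whole_def span_Un by (simp add: span_eq_iff[THEN iffD2, OF subspace_part])

lemma subspace_whole: "subspace (whole F)"
  unfolding whole_eq_span by simp

lemma whole_decomp_unique:
  assumes "x \<in> part F 0" "y \<in> part F 1" "x + y = 0"
  shows "x = 0" "y = 0"
proof -
  have "y = - x" using assms(3) by (simp add: add_eq_0_iff)
  then have "y \<in> part F 0" using assms(1) subspace_neg[OF subspace_part] by blast
  then show "y = 0" using assms(2) part_disjoint by blast
  then show "x = 0" using assms(3) by simp
qed

text \<open>A relation among \<open>B0 \<union> B1\<close> splits into an even and an odd vector
  with sum 0; both vanish because the two parts meet only in 0.\<close>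

lemma union_of_part_bases:
  assumes "B0 \<subseteq> part F 0" "B1 \<subseteq> part F 1" "independent B0" "independent B1"
  shows "independent (B0 \<union> B1)" "B0 \<inter> B1 = {}"
proof -
  have "0 \<notin> B0" using assms(3) dependent_zero by blast
  have "B0 \<inter> B1 \<subseteq> {0}" using Int_mono[OF assms(1,2)] part_disjoint by simp
  then show disj: "B0 \<inter> B1 = {}" using \<open>0 \<notin> B0\<close> by auto
  show "independent (B0 \<union> B1)"
  proof (rule independent_explicit_module[THEN iffD2], intro allI impI)
    fix t u v
    assume t: "finite t" "t \<subseteq> B0 \<union> B1" "(\<Sum>v\<in>t. scl F (u v) v) = 0" "v \<in> t"
    have teq: "t = (t \<inter> B0) \<union> (t \<inter> B1)" using t(2) by blast
    have un: "(\<Sum>v\<in>(t \<inter> B0) \<union> (t \<inter> B1). scl F (u v) v)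
      = (\<Sum>v\<in>t \<inter> B0. scl F (u v) v) + (\<Sum>v\<in>t \<inter> B1. scl F (u v) v)"
      by (rule sum.union_disjoint) (use t(1) disj in auto)
    have sum0: "(\<Sum>v\<in>t \<inter> B0. scl F (u v) v) + (\<Sum>v\<in>t \<inter> B1. scl F (u v) v) = 0"
      by (rule trans[OF un[symmetric] trans[OF sum.cong[OF teq refl, symmetric] t(3)]])
    have in0: "(\<Sum>v\<in>t \<inter> B0. scl F (u v) v) \<in> part F 0"
      by (rule subspace_sum[OF subspace_part], rule subspace_scale[OF subspace_part]) (use assms(1) in blast)
    have in1: "(\<Sum>v\<in>t \<inter> B1. scl F (u v) v) \<in> part F 1"
      by (rule subspace_sum[OF subspace_part], rule subspace_scale[OF subspace_part]) (use assms(2) in blast)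
    have "u v = 0" if "v \<in> t \<inter> B0"
      by (rule independentD[OF assms(3) _ _ whole_decomp_unique(1)[OF in0 in1 sum0] that])
        (use t(1) in blast)+
    moreover have "u v = 0" if "v \<in> t \<inter> B1"
      by (rule independentD[OF assms(4) _ _ whole_decomp_unique(2)[OF in0 in1 sum0] that])
        (use t(1) in blast)+
    ultimately show "u v = 0" using t(2,4) by blast
  qed
qed

text \<open>For a subspace this is the usual condition of being the direct sum of its even and odd
  components. The spanning form combines directly with the bilinearity of the bracket.\<close>

definition graded :: "'v set \<Rightarrow> bool" where
  "graded A \<longleftrightarrow> A \<subseteq> span (A \<inter> (part F 0 \<union> part F 1))"

text \<open>Bases of the two components together form a basis. Finiteness matters:
  \<open>dim\<close> is 0 on infinite-dimensional spaces, so one infinite component would break the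
  equation.\<close>

lemma dim_graded:
  assumes A: "subspace A" "graded A" and fin: "finite B" "A \<subseteq> span B"
  shows "dim A = dim (A \<inter> part F 0) + dim (A \<inter> part F 1)"
proof -
  obtain B0 where B0: "B0 \<subseteq> A \<inter> part F 0" "independent B0" "A \<inter> part F 0 \<subseteq> span B0"
      "card B0 = dim (A \<inter> part F 0)"
    using basis_exists[of "A \<inter> part F 0"] by blast
  obtain B1 where B1: "B1 \<subseteq> A \<inter> part F 1" "independent B1" "A \<inter> part F 1 \<subseteq> span B1"
      "card B1 = dim (A \<inter> part F 1)"
    using basis_exists[of "A \<inter> part F 1"] by blast
  have ind: "independent (B0 \<union> B1)" "B0 \<inter> B1 = {}"
    using union_of_part_bases[of B0 B1] B0 B1 by auto
  have "span (A \<inter> (part F 0 \<union> part F 1)) \<subseteq> span (B0 \<union> B1)"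
    using B0(3) B1(3) span_mono[of B0 "B0 \<union> B1"] span_mono[of B1 "B0 \<union> B1"]
    by (intro span_minimal) auto
  then have sp: "A \<subseteq> span (B0 \<union> B1)" using A(2) unfolding graded_def by blast
  have "card (B0 \<union> B1) = dim A"
    using basis_card_eq_dim[of "B0 \<union> B1" A] B0(1) B1(1) sp ind by auto
  moreover have "finite (B0 \<union> B1)"
    using independent_span_bound[OF fin(1) ind(1)] B0(1) B1(1) fin(2) by blast
  ultimately show ?thesis using B0(4) B1(4) ind(2) by (simp add: card_Un_disjoint)
qed

end

section \<open>Lie superalgebras: bracket, signs and commutators\<close>

locale super_lie =
  fixes F :: "('k::field, 'v::ab_group_add) superalgebra"
  assumes lie: "lie_superalgebra F"
begin

sublocale super_space F
  using lie unfolding lie_superalgebra_def by unfold_locales (rule conjunct1)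

lemmas lie_conjuncts = lie[unfolded lie_superalgebra_def, THEN conjunct2]
lemmas brk_add = lie_conjuncts[THEN conjunct1, rule_format]
lemmas brk_scale = lie_conjuncts[THEN conjunct2, THEN conjunct1, rule_format]
lemmas brk_part = lie_conjuncts[THEN conjunct2, THEN conjunct2, THEN conjunct1, rule_format]
lemmas brk_koszul_skew =
  lie_conjuncts[THEN conjunct2, THEN conjunct2, THEN conjunct2, THEN conjunct1, rule_format]
lemmas brk_koszul_jacobi =
  lie_conjuncts[THEN conjunct2, THEN conjunct2, THEN conjunct2, THEN conjunct2, rule_format]

abbreviation "H \<equiv> whole F"
abbreviation "homog \<equiv> part F 0 \<union> part F 1"
text \<open>Off by one: \<open>D k\<close> is the paper's \<open>\<gamma>\<^bsub>k+1\<^esub>\<close>.\<close>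

abbreviation "D k \<equiv> lower_central F (Suc k)"

lemma homogE:
  assumes "x \<in> homog" obtains a where "x \<in> part F a"
  using assms by blast

lemma homog_whole: "homog \<subseteq> H"
  using part_subset_whole by blast

lemma brk_linear:
  assumes "x \<in> H" "y \<in> H" "z \<in> H"
  shows "brk F (scl F t x + y) z = scl F t (brk F x z) + brk F y z"
    and "brk F z (scl F t x + y) = scl F t (brk F z x) + brk F z y"
proof -
  have "scl F t x \<in> H" using assms subspace_scale[OF subspace_whole] by blast
  then show "brk F (scl F t x + y) z = scl F t (brk F x z) + brk F y z"
    "brk F z (scl F t x + y) = scl F t (brk F z x) + brk F z y"
    using brk_add[of "scl F t x" y z] brk_scale[of x z t] brk_scale[of z x t] assms by auto
qed

lemma brk_0:
  assumes "x \<in> H" shows "brk F 0 x = 0" "brk F x 0 = 0"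
  using brk_scale[of 0 x 0] brk_scale[of x 0 0] assms subspace_0[OF subspace_whole] by auto

lemma part_homog: "part F a \<subseteq> homog"
  by (cases a) auto

lemma brk_homog: "x \<in> homog \<Longrightarrow> y \<in> homog \<Longrightarrow> brk F x y \<in> homog"
  by (meson brk_part homogE part_homog subsetD)

text \<open>Bilinearity is applied in one argument at a time, first for a fixed
  \<open>b \<in> B\<close>. Both inductions carry membership in \<open>H\<close>, outside of which
  nothing is known about the bracket.\<close>

lemma brk_span:
  assumes A: "A \<subseteq> H" and B: "B \<subseteq> H" and x: "x \<in> span A" and y: "y \<in> span B"
  shows "brk F x y \<in> span {brk F a b | a b. a \<in> A \<and> b \<in> B}" (is "_ \<in> span ?S")
proof -
  have sH: "span A \<subseteq> H" "span B \<subseteq> H" using A B span_minimal[OF _ subspace_whole] by auto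
  have 1: "brk F x b \<in> span ?S" if b: "b \<in> B" for b
  proof -
    from x have "x \<in> H \<and> brk F x b \<in> span ?S"
    proof (induction rule: span_induct_alt)
      case base
      show ?case using b B brk_0 subspace_0[OF subspace_whole] by (auto simp: span_zero)
    next
      case (step c x y)
      have "brk F x b \<in> span ?S" using step(1) b by (intro span_base) blast
      moreover have "x \<in> H" "b \<in> H" "y \<in> H" "brk F y b \<in> span ?S" using step b A B by auto
      ultimately show ?case
        by (simp add: brk_linear span_add span_scale subspace_add subspace_scale subspace_whole)
    qed
    then show ?thesis ..
  qed
  from y have "y \<in> H \<and> brk F x y \<in> span ?S"
  proof (induction rule: span_induct_alt)
    case base
    show ?case using x sH brk_0 subspace_0[OF subspace_whole] by (auto simp: span_zero)
  next
    case (step c b y)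
    then have "x \<in> H" "b \<in> H" "y \<in> H" "brk F x y \<in> span ?S" "brk F x b \<in> span ?S"
      using x sH B 1 by auto
    then show ?case
      by (simp add: brk_linear span_add span_scale subspace_add subspace_scale subspace_whole)
  qed
  then show ?thesis ..
qed

lemma brk_in_commutator: "a \<in> A \<Longrightarrow> b \<in> B \<Longrightarrow> brk F a b \<in> commutator F A B"
  unfolding commutator_def by (intro span_base) blast

lemma subspace_commutator: "subspace (commutator F A B)"
  unfolding commutator_def by simp

lemma brk_whole:
  assumes "x \<in> H" "y \<in> H" shows "brk F x y \<in> H"
proof -
  have "brk F x y \<in> span {brk F a b | a b. a \<in> homog \<and> b \<in> homog}"
    by (rule brk_span[OF homog_whole homog_whole]) (use assms in \<open>simp_all flip: whole_eq_span\<close>)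
  also have "\<dots> \<subseteq> H"
    using brk_homog homog_whole by (intro span_minimal subspace_whole) blast
  finally show ?thesis .
qed

lemma commutator_whole: "A \<subseteq> H \<Longrightarrow> B \<subseteq> H \<Longrightarrow> commutator F A B \<subseteq> H"
  unfolding commutator_def using brk_whole by (intro span_minimal subspace_whole) blast

lemma commutator_least:
  assumes "\<And>a b. a \<in> A \<Longrightarrow> b \<in> B \<Longrightarrow> brk F a b \<in> U" "subspace U"
  shows "commutator F A B \<subseteq> U"
  unfolding commutator_def using assms by (intro span_minimal) blast+

text \<open>The sign rules concern homogeneous elements only; this reduction extends their
  consequences to all of two graded sets.\<close>

lemma graded_brk_induct:
  assumes A: "A \<subseteq> H" "graded A" and B: "B \<subseteq> H" "graded B" and U: "subspace U"
    and hom: "\<And>a b. a \<in> A \<Longrightarrow> b \<in> B \<Longrightarrow> a \<in> homog \<Longrightarrow> b \<in> homog \<Longrightarrow> brk F a b \<in> U"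
    and ab: "a \<in> A" "b \<in> B"
  shows "brk F a b \<in> U"
proof -
  have "brk F a b \<in> span {brk F a b | a b. a \<in> A \<inter> homog \<and> b \<in> B \<inter> homog}"
  proof (rule brk_span)
    show "a \<in> span (A \<inter> homog)" using A(2) ab(1) unfolding graded_def by (rule subsetD)
    show "b \<in> span (B \<inter> homog)" using B(2) ab(2) unfolding graded_def by (rule subsetD)
  qed (use A(1) B(1) in auto)
  also have "\<dots> \<subseteq> U"
  proof (rule span_minimal[OF _ U], rule subsetI)
    fix z assume "z \<in> {brk F a b | a b. a \<in> A \<inter> homog \<and> b \<in> B \<inter> homog}"
    then obtain a b where "z = brk F a b" "a \<in> A \<inter> homog" "b \<in> B \<inter> homog" by blast
    then show "z \<in> U" using hom[of a b] by simp
  qed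
  finally show ?thesis .
qed

lemma graded_commutator:
  assumes A: "A \<subseteq> H" "graded A" and B: "B \<subseteq> H" "graded B"
  shows "graded (commutator F A B)"
  unfolding graded_def
proof (rule commutator_least, rule graded_brk_induct[OF A B])
  fix a b assume "a \<in> A" "b \<in> B" "a \<in> homog" "b \<in> homog"
  then show "brk F a b \<in> span (commutator F A B \<inter> homog)"
    using brk_homog brk_in_commutator by (intro span_base) blast
qed simp_all

lemma graded_whole: "graded H"
  unfolding graded_def using homog_whole whole_eq_span by (metis Int_absorb1 order_refl)

lemma koszul_nonzero: "koszul a b \<noteq> (0 :: 'k)"
  unfolding koszul_def by simp

text \<open>Only membership in subspaces matters later, so the sign is weakened to some nonzero
  scalar \<open>e\<close>.\<close>

lemma brk_skew:
  assumes "x \<in> homog" "y \<in> homog"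
  obtains e where "e \<noteq> 0" "brk F x y = scl F e (brk F y x)"
proof -
  obtain a b where ab: "x \<in> part F a" "y \<in> part F b" using assms by blast
  then have "brk F x y = scl F (- koszul a b) (brk F y x)"
    using brk_koszul_skew[OF ab] by (simp only: scale_minus_left)
  moreover have "- koszul a b \<noteq> (0 :: 'k)"
    using koszul_nonzero[of a b] by simp
  ultimately show ?thesis using that by blast
qed

lemma brk_skew_mem:
  assumes "x \<in> homog" "y \<in> homog" "subspace U" "brk F y x \<in> U"
  shows "brk F x y \<in> U"
  using brk_skew[OF assms(1,2)] assms(3,4) subspace_scale by metis

text \<open>The scalar in skew-symmetry varies with the degrees, so the swap is made on homogeneous
  elements and then extended by linearity.\<close>

lemma brk_skew_mem_graded:
  assumes A: "A \<subseteq> H" "graded A" and B: "B \<subseteq> H" "graded B"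
    and "x \<in> A" "y \<in> B"
  shows "brk F x y \<in> commutator F B A"
  by (rule graded_brk_induct[OF A B subspace_commutator _ assms(5,6)])
    (rule brk_skew_mem[OF _ _ subspace_commutator brk_in_commutator])

text \<open>On even elements the bracket is skew-symmetric in the ordinary sense, so twice the
  square is 0. Hence only odd elements contribute squares to the generators of
  \<open>D 1\<close>.\<close>

lemma brk_even_self:
  assumes "CHAR('k) \<noteq> 2" "x \<in> part F 0"
  shows "brk F x x = 0"
proof -
  have "brk F x x = - brk F x x"
    using brk_koszul_skew[OF assms(2) assms(2)] by (simp add: koszul_def)
  then have "scl F (of_nat 2) (brk F x x) = 0"
    by (metis add.right_inverse of_nat_numeral one_add_one scale_left_distrib scale_one)
  moreover have "(of_nat 2 :: 'k) \<noteq> 0"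
  proof
    assume "(of_nat 2 :: 'k) = 0"
    then have "CHAR('k) dvd 2" by (rule of_nat_eq_0_iff_char_dvd[THEN iffD1])
    moreover from this have "CHAR('k) \<le> 2" by (rule dvd_imp_le) simp
    moreover have "CHAR('k) \<noteq> Suc 0" by (rule CHAR_not_1')
    ultimately show False using assms(1) by (cases "CHAR('k) = 0") auto
  qed
  ultimately show ?thesis by simp
qed

text \<open>Skew-symmetry rewrites two terms of the graded identity as left-normed brackets. The
  signs disappear into nonzero scalars, which suffices to solve for any one term.\<close>

lemma jacobi:
  assumes "u \<in> homog" "x \<in> homog" "y \<in> homog"
  obtains e1 e2 e3 where "e1 \<noteq> 0" "e2 \<noteq> 0" "e3 \<noteq> 0"
    "scl F e1 (brk F (brk F u x) y) + scl F e2 (brk F (brk F u y) x)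
      + scl F e3 (brk F u (brk F x y)) = 0"
proof -
  obtain a b c where abc: "u \<in> part F a" "x \<in> part F b" "y \<in> part F c" using assms by blast
  obtain e where e: "e \<noteq> 0" "brk F y (brk F u x) = scl F e (brk F (brk F u x) y)"
    using brk_skew[of y "brk F u x"] assms brk_homog by blast
  obtain e' where e': "e' \<noteq> 0" "brk F y u = scl F e' (brk F u y)"
    using brk_skew[of y u] assms by blast
  obtain e'' where e'': "e'' \<noteq> 0" "brk F x (brk F u y) = scl F e'' (brk F (brk F u y) x)"
    using brk_skew[of x "brk F u y"] assms brk_homog by blast
  have "brk F x (brk F y u) = scl F e' (brk F x (brk F u y))"
    using brk_scale[of x "brk F u y" e'] assms e'(2) homog_whole brk_whole by auto
  then have J2: "brk F x (brk F y u) = scl F (e' * e'') (brk F (brk F u y) x)"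
    using e''(2) by simp
  have "scl F (koszul a c) (brk F u (brk F x y)) + scl F (koszul b a) (brk F x (brk F y u)) +
        scl F (koszul c b) (brk F y (brk F u x)) = 0"
    by (rule brk_koszul_jacobi[OF abc])
  then have "scl F (koszul c b * e) (brk F (brk F u x) y)
      + scl F (koszul b a * (e' * e'')) (brk F (brk F u y) x)
      + scl F (koszul a c) (brk F u (brk F x y)) = 0"
    unfolding J2 e(2) by (simp add: ac_simps)
  moreover have "koszul c b * e \<noteq> 0" "koszul b a * (e' * e'') \<noteq> 0"
    using koszul_nonzero[of c b] koszul_nonzero[of b a] e(1) e'(1) e''(1) by simp_all
  ultimately show ?thesis using that koszul_nonzero by blast
qed

lemma mem_of_relation:
  assumes "scl F e x + v = 0" "e \<noteq> 0" "v \<in> U" "subspace U"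
  shows "x \<in> U"
proof -
  have "scl F e x = - v" using assms(1) by (simp add: eq_neg_iff_add_eq_0)
  then have "scl F e x \<in> U" using assms(3,4) subspace_neg by simp
  then have "scl F (inverse e) (scl F e x) \<in> U" using assms(4) subspace_scale by blast
  then show ?thesis using assms(2) by simp
qed

text \<open>Solving the Jacobi relation for one term shows that a subspace containing the other two
  contains it as well. The next lemma solves for the term that is not left-normed.\<close>

lemma jacobi_mem1:
  assumes "u \<in> homog" "x \<in> homog" "y \<in> homog" "subspace U"
    "brk F (brk F u y) x \<in> U" "brk F u (brk F x y) \<in> U"
  shows "brk F (brk F u x) y \<in> U"
proof (rule jacobi[OF assms(1-3)])
  fix e1 e2 e3
  assume e1: "e1 \<noteq> 0" and J: "scl F e1 (brk F (brk F u x) y) + scl F e2 (brk F (brk F u y) x)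
      + scl F e3 (brk F u (brk F x y)) = 0"
  have "scl F e2 (brk F (brk F u y) x) + scl F e3 (brk F u (brk F x y)) \<in> U"
    by (intro subspace_add subspace_scale assms(4-6))
  with J[unfolded add.assoc] e1 show ?thesis using mem_of_relation assms(4) by blast
qed

lemma jacobi_mem2:
  assumes "u \<in> homog" "x \<in> homog" "y \<in> homog" "subspace U"
    "brk F (brk F u x) y \<in> U" "brk F (brk F u y) x \<in> U"
  shows "brk F u (brk F x y) \<in> U"
proof (rule jacobi[OF assms(1-3)])
  fix e1 e2 e3
  assume e3: "e3 \<noteq> 0" and J: "scl F e1 (brk F (brk F u x) y) + scl F e2 (brk F (brk F u y) x)
      + scl F e3 (brk F u (brk F x y)) = 0"
  have "scl F e1 (brk F (brk F u x) y) + scl F e2 (brk F (brk F u y) x) \<in> U"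
    by (intro subspace_add subspace_scale assms(4-6))
  with J[unfolded add.commute[of _ "scl F e3 _"]] e3 show ?thesis using mem_of_relation assms(4) by blast
qed

section \<open>The lower central series\<close>

lemma D_0: "D 0 = H"
  unfolding lower_central_def by simp

lemma D_Suc: "D (Suc k) = commutator F (D k) H"
  unfolding lower_central_def by simp

lemma D_props: "D k \<subseteq> H" "subspace (D k)" "graded (D k)"
proof -
  have "D k \<subseteq> H \<and> subspace (D k) \<and> graded (D k)"
  proof (induction k)
    case 0
    show ?case unfolding D_0 using subspace_whole graded_whole by simp
  next
    case (Suc k)
    then show ?case unfolding D_Suc
      using commutator_whole subspace_commutator graded_commutator graded_whole by simp
  qed
  then show "D k \<subseteq> H" "subspace (D k)" "graded (D k)" by auto
qed

lemma D_decreasing: "D (Suc k) \<subseteq> D k"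
proof (induction k)
  case 0
  show ?case unfolding D_0 using D_props(1) by blast
next
  case (Suc k)
  show ?case unfolding D_Suc[of "Suc k"]
  proof (rule commutator_least[OF _ D_props(2)])
    fix a b assume "a \<in> D (Suc k)" "b \<in> H"
    then show "brk F a b \<in> D (Suc k)"
      unfolding D_Suc[of k] using Suc by (intro brk_in_commutator) (auto simp: D_Suc[of k])
  qed
qed

lemma D_antimono: "i \<le> j \<Longrightarrow> D j \<subseteq> D i"
  using lift_Suc_antimono_le[of "\<lambda>k. D k"] D_decreasing by blast

text \<open>Each term determines the next, so one repetition freezes the series. In a nilpotent
  algebra this forces strict descent until 0 is reached.\<close>

lemma D_stationary: "D (Suc k) = D k \<Longrightarrow> D (k + i) = D k"
  by (induction i) (simp_all add: D_Suc)

lemma brk_D: "a \<in> D k \<Longrightarrow> b \<in> H \<Longrightarrow> brk F a b \<in> D (Suc k)"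
  unfolding D_Suc by (rule brk_in_commutator)

text \<open>By Jacobi, [a, [x, y]] is a combination of [[a, x], y] and [[a, y], x], both two steps
  below \<open>D k\<close>. It follows that a bracket of \<open>D k\<close> with \<open>H\<close>,
  taken modulo \<open>D (k + 2)\<close>, depends on its second argument only modulo
  \<open>D 1\<close>.\<close>

lemma brk_D_D1:
  assumes "a \<in> D k" "b \<in> D 1"
  shows "brk F a b \<in> D (k + 2)"
proof (rule graded_brk_induct[OF D_props(1,3) D_props(1,3) D_props(2) _ assms])
  fix a b assume a: "a \<in> D k" "a \<in> homog" and "b \<in> D 1" "b \<in> homog"
  have "b \<in> span {brk F x y | x y. x \<in> homog \<and> y \<in> homog}"
  proof -
    have "D 1 \<subseteq> span {brk F x y | x y. x \<in> homog \<and> y \<in> homog}"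
      unfolding One_nat_def D_Suc D_0
    proof (rule commutator_least[OF _ subspace_span])
      fix a b assume ab: "a \<in> H" "b \<in> H"
      show "brk F a b \<in> span {brk F x y | x y. x \<in> homog \<and> y \<in> homog}"
        by (rule graded_brk_induct[OF order_refl graded_whole order_refl graded_whole subspace_span _ ab])
          (rule span_base, blast)
    qed
    then show ?thesis using \<open>b \<in> D 1\<close> by blast
  qed
  then have "brk F a b \<in> span {brk F a' b' | a' b'. a' \<in> {a} \<and> b' \<in> {brk F x y | x y. x \<in> homog \<and> y \<in> homog}}"
    using a homog_whole brk_homog by (intro brk_span) (blast intro: span_base)+
  also have "\<dots> \<subseteq> D (k + 2)"
  proof (rule span_minimal[OF _ D_props(2)], clarify)
    fix x y assume xy: "x \<in> homog" "y \<in> homog"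
    then have "x \<in> H" "y \<in> H" using homog_whole by auto
    then show "brk F a (brk F x y) \<in> D (k + 2)"
      using a xy brk_D[of a k] brk_D[of _ "Suc k"] by (intro jacobi_mem2 D_props(2)) simp_all
  qed
  finally show "brk F a b \<in> D (k + 2)" .
qed

text \<open>Changing \<open>a\<close> by \<open>D (Suc k)\<close> or \<open>R\<close>, or
  \<open>b\<close> by \<open>D 1\<close> or \<open>R\<close>, alters the bracket only within
  \<open>D (k + 2)\<close> and [H, R]. \<open>X\<close> need not generate \<open>H\<close>; only
  \<open>b\<close> has to be reached, so the lemma also applies to a subset of the
  generators.\<close>

lemma brk_D_span:
  assumes Y: "Y \<subseteq> D k" "D k \<subseteq> span (Y \<union> D (Suc k) \<union> R)"
    and X: "X \<subseteq> H" and R: "R \<subseteq> H" "graded R"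
    and a: "a \<in> D k" and b: "b \<in> span (X \<union> D 1 \<union> R)"
  shows "brk F a b \<in> span ({brk F y x | y x. y \<in> Y \<and> x \<in> X} \<union> D (k + 2) \<union> commutator F H R)"
    (is "_ \<in> span ?S")
proof -
  have Yk: "Y \<subseteq> H" using Y(1) D_props(1) by blast
  have "brk F a b \<in> span {brk F a' b' | a' b'. a' \<in> Y \<union> D (Suc k) \<union> R \<and> b' \<in> X \<union> D 1 \<union> R}"
    using Yk D_props(1) R X a b Y(2) by (intro brk_span) auto
  also have "\<dots> \<subseteq> span ?S"
  proof (rule span_mono, clarify)
    \<comment> \<open>What remains are the brackets outside [H, R] and \<open>D (k + 2)\<close>; all
      choices of \<open>a'\<close> and \<open>b'\<close> except \<open>a' \<in> Y\<close>,
      \<open>b' \<in> X\<close> are ruled out in turn.\<close>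
    fix a' b' assume a': "a' \<in> Y \<union> D (Suc k) \<union> R" and b': "b' \<in> X \<union> D 1 \<union> R"
      and n1: "brk F a' b' \<notin> commutator F H R" and n2: "brk F a' b' \<notin> D (k + 2)"
    have aH: "a' \<in> H" and bH: "b' \<in> H" using a' b' Yk D_props(1) R(1) X by auto
    have "b' \<notin> R" using n1 aH brk_in_commutator by blast
    moreover have "a' \<notin> R" using n1 bH brk_skew_mem_graded[OF R order_refl graded_whole] by blast
    moreover have "a' \<notin> D (Suc k)" using n2 bH brk_D[of a' "Suc k" b'] by auto
    ultimately have "a' \<in> Y" "b' \<in> X \<union> D 1" using a' b' by auto
    moreover have "b' \<notin> D 1" using n2 \<open>a' \<in> Y\<close> Y(1) brk_D_D1 by blast
    ultimately show "\<exists>y x. brk F a' b' = brk F y x \<and> y \<in> Y \<and> x \<in> X" by blast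
  qed
  finally show ?thesis .
qed

section \<open>Left-normed words in homogeneous elements\<close>

lemma foldl_brk_props:
  assumes "x0 \<in> homog" "set xs \<subseteq> homog"
  shows "foldl (brk F) x0 xs \<in> homog \<and> foldl (brk F) x0 xs \<in> D (length xs)"
  using assms(2)
proof (induction xs rule: rev_induct)
  case Nil
  then show ?case using assms(1) homog_whole D_0 by auto
next
  case (snoc x xs)
  then have "x \<in> H" using homog_whole by auto
  with snoc show ?case using brk_homog brk_D by simp
qed

text \<open>Source of the correction sum in the final bound: bracketing a word with any
  \<open>y\<close> can be rewritten so that the last entry is a letter of the word. The word loses
  its last letter \<open>x\<close> through [[u, x], y], which Jacobi expresses by [[u, y], x] and
  [u, [x, y]].\<close>

lemma brk_foldl_mem:
  assumes "x0 \<in> homog" "set xs \<subseteq> homog" "y \<in> D k" "y \<in> homog"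
  shows "brk F (foldl (brk F) x0 xs) y \<in>
    span {brk F a x | a x. a \<in> D (k + length xs) \<and> x \<in> set (x0 # xs)}"
  using assms(2-4)
proof (induction xs arbitrary: y k rule: rev_induct)
  case Nil
  then have "brk F y x0 \<in> span {brk F a x | a x. a \<in> D (k + length []) \<and> x \<in> set [x0]}"
    by (intro span_base) auto
  then show ?case
    unfolding foldl.simps by (rule brk_skew_mem[OF assms(1) Nil.prems(3) subspace_span])
next
  case (snoc x xs)
  let ?u = "foldl (brk F) x0 xs"
  have u: "?u \<in> homog" using foldl_brk_props assms(1) snoc.prems by simp
  have x: "x \<in> homog" "x \<in> H" using snoc.prems homog_whole by auto
  have x0: "set (x0 # xs) \<subseteq> H" using snoc.prems assms(1) homog_whole by auto
  have "brk F ?u y \<in> span {brk F a x | a x. a \<in> D (k + length xs) \<and> x \<in> set (x0 # xs)}"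
    using snoc by simp
  also have "\<dots> \<subseteq> D (k + length (xs @ [x]))"
  proof (rule span_minimal)
    show "{brk F a x | a x. a \<in> D (k + length xs) \<and> x \<in> set (x0 # xs)} \<subseteq> D (k + length (xs @ [x]))"
      using brk_D[of _ "k + length xs"] x0 by auto
  qed (rule D_props)
  finally have 1: "brk F ?u y \<in> D (k + length (xs @ [x]))" .
  \<comment> \<open>[x, y] lies one step deeper, which makes up for the word being one letter
    shorter; hence the induction over all \<open>y\<close> and \<open>k\<close>.\<close>
  have "brk F x y \<in> D (Suc k)"
    using brk_skew_mem[OF x(1) snoc.prems(3) D_props(2)] brk_D x(2) snoc.prems(2) by blast
  then have "brk F ?u (brk F x y) \<in>
      span {brk F a x | a x. a \<in> D (Suc k + length xs) \<and> x \<in> set (x0 # xs)}"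
    using snoc.prems x brk_homog by (intro snoc.IH) auto
  also have "\<dots> \<subseteq> span {brk F a x' | a x'. a \<in> D (k + length (xs @ [x])) \<and> x' \<in> set (x0 # xs @ [x])}"
    by (rule span_mono) auto
  finally have 2: "brk F ?u (brk F x y) \<in> \<dots>" .
  show ?case unfolding foldl_append foldl.simps
    by (rule jacobi_mem1[OF u x(1) snoc.prems(3) subspace_span _ 2])
      (use 1 in \<open>auto intro!: span_base\<close>)
qed

text \<open>Left-normed brackets of weight \<open>k + 1\<close>: the first letter is kept apart, so
  that \<open>k\<close> agrees with the index of \<open>D k\<close>.\<close>

definition words :: "'v set \<Rightarrow> nat \<Rightarrow> 'v set" where
  "words X k = {foldl (brk F) x0 xs | x0 xs. x0 \<in> X \<and> set xs \<subseteq> X \<and> length xs = k}"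

lemma words_D: "X \<subseteq> homog \<Longrightarrow> words X k \<subseteq> D k"
  unfolding words_def using foldl_brk_props by blast

text \<open>Bracketing a word with one more generator gives a word again, so
  \<open>brk_D_span\<close> carries the claim from \<open>k\<close> to \<open>Suc k\<close>. Since
  \<open>R\<close> is an ideal, it absorbs the error term [H, R].\<close>

lemma words_span:
  assumes X: "X \<subseteq> homog" "H \<subseteq> span (X \<union> D 1 \<union> R)"
    and R: "R \<subseteq> H" "graded R" "commutator F H R \<subseteq> R"
  shows "D k \<subseteq> span (words X k \<union> D (Suc k) \<union> R)"
proof (induction k)
  case 0
  have "words X 0 = X" unfolding words_def by auto
  then show ?case using X(2) D_0 by simp
next
  case (Suc k)
  have w: "brk F y x \<in> words X (Suc k)" if y: "y \<in> words X k" and x: "x \<in> X" for x y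
  proof -
    obtain x0 xs where "y = foldl (brk F) x0 xs" "x0 \<in> X" "set xs \<subseteq> X" "length xs = k"
      using y unfolding words_def by blast
    with x have "brk F y x = foldl (brk F) x0 (xs @ [x]) \<and> x0 \<in> X \<and> set (xs @ [x]) \<subseteq> X
        \<and> length (xs @ [x]) = Suc k" by simp
    then show ?thesis unfolding words_def by blast
  qed
  have "X \<subseteq> H" using X(1) homog_whole by blast
  have "brk F a b \<in> span (words X (Suc k) \<union> D (Suc (Suc k)) \<union> R)" if "a \<in> D k" "b \<in> H" for a b
  proof -
    have "brk F a b \<in> span ({brk F y x | y x. y \<in> words X k \<and> x \<in> X} \<union> D (k + 2) \<union> commutator F H R)"
      using brk_D_span[OF words_D[OF X(1)] Suc \<open>X \<subseteq> H\<close> R(1,2) that(1)] that(2) X(2) by blast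
    also have "\<dots> \<subseteq> span (words X (Suc k) \<union> D (Suc (Suc k)) \<union> R)"
      by (rule span_mono) (use w R(3) in auto)
    finally show ?thesis .
  qed
  then show ?case unfolding D_Suc[of k] by (intro commutator_least) auto
qed

section \<open>Spanning sets for the derived algebra modulo [F, R]\<close>

lemma brk_pairs_span:
  assumes "finite X" "X \<subseteq> homog"
  shows "\<exists>S. finite S \<and> card S \<le> card X choose 2 \<and>
    (\<forall>x\<in>X. \<forall>y\<in>X. x \<noteq> y \<longrightarrow> brk F x y \<in> span S)"
  using assms
proof (induction X rule: finite_induct)
  case empty
  show ?case by (intro exI[of _ "{}"]) simp
next
  case (insert a X)
  then obtain S where S: "finite S" "card S \<le> card X choose 2"
    "\<forall>x\<in>X. \<forall>y\<in>X. x \<noteq> y \<longrightarrow> brk F x y \<in> span S" by auto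
  let ?S = "S \<union> brk F a ` X"
  have "card ?S \<le> card S + card X"
    by (rule order_trans[OF card_Un_le]) (simp add: card_image_le insert.hyps(1))
  also have "\<dots> \<le> card (insert a X) choose 2"
    using S(2) insert.hyps by (simp add: numeral_2_eq_2)
  finally have c: "card ?S \<le> card (insert a X) choose 2" .
  have ax: "brk F a x \<in> span ?S" if "x \<in> X" for x using that by (auto intro: span_base)
  have xa: "brk F x a \<in> span ?S" if "x \<in> X" for x
    by (rule brk_skew_mem) (use that insert.prems ax in auto)
  have "span S \<subseteq> span ?S" by (rule span_mono) auto
  then show ?case
    using c S(1,3) ax xa insert.hyps(1) by (intro exI[of _ ?S]) auto
qed

text \<open>All brackets of \<open>Y\<close> with \<open>X\<close> span \<open>D (Suc k)\<close>
  modulo \<open>D (k + 2)\<close> and [H, R]. For one word \<open>u\<close> of \<open>Y\<close>, the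
  brackets with generators that are not letters of \<open>u\<close> are redundant. As
  \<open>u\<close> has at most \<open>Suc k\<close> distinct letters, at least
  \<open>card X - Suc k\<close> brackets are saved; the subtraction truncates to 0 when
  \<open>X\<close> is small.\<close>

lemma commutator_step_span:
  assumes X: "finite X" "X \<subseteq> homog" "H \<subseteq> span (X \<union> D 1 \<union> R)"
    and R: "R \<subseteq> H" "graded R"
    and Y: "finite Y" "Y \<subseteq> words X k" "Y \<noteq> {}" "D k \<subseteq> span (Y \<union> D (Suc k) \<union> R)"
  shows "\<exists>S. finite S \<and> card S + (card X - Suc k) \<le> card Y * card X \<and>
    D (Suc k) \<subseteq> span (S \<union> D (k + 2) \<union> commutator F H R)"
proof -
  obtain u where "u \<in> Y" using Y(3) by blast
  then obtain x0 xs where u: "u = foldl (brk F) x0 xs" "x0 \<in> X" "set xs \<subseteq> X" "length xs = k"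
    using Y(2) unfolding words_def by blast
  define Z where "Z = set (x0 # xs)"
  \<comment> \<open>The index pairs that are kept. Every pair whose second entry is a letter of
    \<open>u\<close> survives, so \<open>Dz\<close> does not rely on the omitted brackets.\<close>
  define Q where "Q = Y \<times> X - {u} \<times> (X - Z)"
  define S where "S = (\<lambda>(y, x). brk F y x) ` Q"
  let ?T = "span (S \<union> D (k + 2) \<union> commutator F H R)"
  have ZX: "Z \<subseteq> X" using u unfolding Z_def by simp
  have XH: "X \<subseteq> H" using X(2) homog_whole by blast
  have YD: "Y \<subseteq> D k" using Y(2) words_D[OF X(2)] by blast
  have Q: "brk F y x \<in> ?T" if "(y, x) \<in> Q" for x y
    using that unfolding S_def by (intro span_base) force
  \<comment> \<open>Brackets of all of \<open>D k\<close> with a letter of \<open>u\<close> are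
    already covered: \<open>brk_D_span\<close> is used with \<open>Z\<close> in place of
    \<open>X\<close>.\<close>
  have Dz: "brk F a x \<in> ?T" if "a \<in> D k" "x \<in> Z" for a x
  proof -
    have "brk F a x \<in> span ({brk F y x | y x. y \<in> Y \<and> x \<in> Z} \<union> D (k + 2) \<union> commutator F H R)"
      by (rule brk_D_span[OF YD Y(4) _ R that(1)]) (use ZX XH that(2) in \<open>auto intro: span_base\<close>)
    also have "\<dots> \<subseteq> ?T"
    proof (rule span_minimal[OF _ subspace_span])
      have "{brk F y x | y x. y \<in> Y \<and> x \<in> Z} \<subseteq> ?T"
        using Q ZX unfolding Q_def by blast
      then show "{brk F y x | y x. y \<in> Y \<and> x \<in> Z} \<union> D (k + 2) \<union> commutator F H R \<subseteq> ?T"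
        by (auto intro: span_base)
    qed
    finally show ?thesis .
  qed
  \<comment> \<open>The omitted brackets are recovered: \<open>brk_foldl_mem\<close> at index 0,
    where \<open>D 0\<close> is all of \<open>H\<close>, moves the letters of \<open>u\<close> to
    the last place.\<close>
  have uz: "brk F u z \<in> ?T" if "z \<in> X" for z
  proof -
    have "brk F u z \<in> span {brk F a x | a x. a \<in> D (0 + length xs) \<and> x \<in> set (x0 # xs)}"
      unfolding u(1) by (rule brk_foldl_mem) (use u X(2) XH D_0 that in auto)
    also have "\<dots> \<subseteq> ?T"
      by (rule span_minimal[OF _ subspace_span]) (use Dz u(4) in \<open>auto simp: Z_def\<close>)
    finally show ?thesis .
  qed
  have yx: "brk F y x \<in> ?T" if "y \<in> Y" "x \<in> X" for y x
    using Q[of y x] uz[of x] that unfolding Q_def by blast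
  have "brk F a b \<in> ?T" if "a \<in> D k" "b \<in> H" for a b
  proof -
    have "brk F a b \<in> span ({brk F y x | y x. y \<in> Y \<and> x \<in> X} \<union> D (k + 2) \<union> commutator F H R)"
      by (rule brk_D_span[OF YD Y(4) XH R that(1)]) (use X(3) that(2) in blast)
    also have "\<dots> \<subseteq> ?T"
    proof (rule span_minimal[OF _ subspace_span])
      have "{brk F y x | y x. y \<in> Y \<and> x \<in> X} \<subseteq> ?T" using yx by blast
      then show "{brk F y x | y x. y \<in> Y \<and> x \<in> X} \<union> D (k + 2) \<union> commutator F H R \<subseteq> ?T"
        by (auto intro: span_base)
    qed
    finally show ?thesis .
  qed
  then have D: "D (Suc k) \<subseteq> ?T" unfolding D_Suc[of k] by (intro commutator_least) auto
  have "card Q = card Y * card X - card (X - Z)"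
    unfolding Q_def using \<open>u \<in> Y\<close> X(1) Y(1)
    by (subst card_Diff_subset) (auto simp: card_cartesian_product)
  \<comment> \<open>This keeps the natural subtraction in the formula for \<open>card Q\<close> from
    truncating.\<close>
  moreover have "card (X - Z) \<le> card Y * card X"
  proof -
    have "card (X - Z) \<le> 1 * card X" using X(1) by (simp add: card_mono)
    also have "\<dots> \<le> card Y * card X"
      using Y(1,3) by (intro mult_right_mono) (simp_all add: Suc_le_eq card_gt_0_iff)
    finally show ?thesis .
  qed
  moreover have "card X - Suc k \<le> card (X - Z)"
  proof -
    have "card Z \<le> Suc k" unfolding Z_def using card_length[of "x0 # xs"] u(4) by simp
    then show ?thesis using ZX X(1) by (simp add: card_Diff_subset finite_subset)
  qed
  moreover have "card S \<le> card Q"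
    unfolding S_def by (rule card_image_le) (use X(1) Y(1) in \<open>simp add: Q_def\<close>)
  ultimately have "card S + (card X - Suc k) \<le> card Y * card X" by linarith
  moreover have "finite S" unfolding S_def Q_def using X(1) Y(1) by simp
  ultimately show ?thesis using D by blast
qed

text \<open>At the first level both entries of a bracket are generators, so skew-symmetry leaves one
  bracket per unordered pair of distinct elements, plus the squares of the odd generators.\<close>

lemma derived_span:
  assumes char: "CHAR('k) \<noteq> 2"
    and X: "finite X" "X \<subseteq> homog" "H \<subseteq> span (X \<union> D 1 \<union> R)"
    and R: "R \<subseteq> H" "graded R"
  shows "\<exists>S. finite S \<and> card S \<le> (card X choose 2) + card (X \<inter> part F 1) \<and>
    D 1 \<subseteq> span (S \<union> D 2 \<union> commutator F H R)"
proof -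
  obtain S where S: "finite S" "card S \<le> card X choose 2"
    "\<forall>x\<in>X. \<forall>y\<in>X. x \<noteq> y \<longrightarrow> brk F x y \<in> span S"
    using brk_pairs_span[OF X(1,2)] by blast
  define S' where "S' = S \<union> (\<lambda>x. brk F x x) ` (X \<inter> part F 1)"
  let ?T = "span (S' \<union> D 2 \<union> commutator F H R)"
  have XH: "X \<subseteq> H" using X(2) homog_whole by blast
  have yx: "brk F y x \<in> ?T" if "y \<in> X" and x: "x \<in> X" for y x
  proof -
    consider "y \<noteq> x" | "y = x" "x \<in> part F 0" | "y = x" "x \<in> part F 1" using X(2) x by blast
    then show ?thesis
    proof cases
      case 1
      have "span S \<subseteq> ?T" by (rule span_mono) (auto simp: S'_def)
      then show ?thesis using S(3) 1 that by blast
    next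
      case 2
      then show ?thesis using brk_even_self[OF char] by (simp add: span_zero)
    next
      case 3
      then show ?thesis using that by (intro span_base) (simp add: S'_def)
    qed
  qed
  have "brk F a b \<in> ?T" if "a \<in> H" "b \<in> H" for a b
  proof -
    have "brk F a b \<in> span ({brk F y x | y x. y \<in> X \<and> x \<in> X} \<union> D (0 + 2) \<union> commutator F H R)"
      by (rule brk_D_span[OF _ _ XH R]) (use X(3) XH that in \<open>auto simp: D_0\<close>)
    also have "\<dots> \<subseteq> ?T"
    proof (rule span_minimal[OF _ subspace_span])
      have "{brk F y x | y x. y \<in> X \<and> x \<in> X} \<subseteq> ?T" using yx by blast
      then show "{brk F y x | y x. y \<in> X \<and> x \<in> X} \<union> D (0 + 2) \<union> commutator F H R \<subseteq> ?T"
        using span_superset[of "S' \<union> D 2 \<union> commutator F H R"] by (simp add: numeral_2_eq_2)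
    qed
    finally show ?thesis .
  qed
  then have D: "D 1 \<subseteq> ?T" unfolding One_nat_def D_Suc D_0 by (intro commutator_least) auto
  have "card S' \<le> card S + card ((\<lambda>x. brk F x x) ` (X \<inter> part F 1))"
    unfolding S'_def by (rule card_Un_le)
  also have "\<dots> \<le> (card X choose 2) + card (X \<inter> part F 1)"
    by (intro add_mono S(2) card_image_le) (use X(1) in simp)
  finally show ?thesis using D S(1) X(1) by (intro exI[of _ S']) (simp add: S'_def)
qed

text \<open>The spanning sets of the successive levels are united. The descent ends because
  \<open>D c\<close> lies in \<open>R\<close>, which puts \<open>D (Suc c)\<close> into
  [H, R].\<close>

lemma derived_span_mod_central:
  assumes char: "CHAR('k) \<noteq> 2"
    and X: "finite X" "X \<subseteq> homog" "H \<subseteq> span (X \<union> D 1 \<union> R)"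
    and R: "R \<subseteq> H" "graded R"
    and Y: "\<And>k. k \<in> {1..<c} \<Longrightarrow> finite (Y k) \<and> Y k \<subseteq> words X k \<and> Y k \<noteq> {} \<and>
      D k \<subseteq> span (Y k \<union> D (Suc k) \<union> R)"
    and c: "c \<ge> 1" "D c \<subseteq> R"
  shows "\<exists>S. finite S \<and>
    card S + (\<Sum>k=1..<c. card X - Suc k)
      \<le> (card X choose 2) + card (X \<inter> part F 1) + (\<Sum>k=1..<c. card (Y k)) * card X \<and>
    D 1 \<subseteq> span (S \<union> commutator F H R)"
proof -
  let ?K = "commutator F H R"
  obtain S0 where S0: "finite S0" "card S0 \<le> (card X choose 2) + card (X \<inter> part F 1)"
    "D 1 \<subseteq> span (S0 \<union> D 2 \<union> ?K)"
    using derived_span[OF char X R] by blast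
  have "\<forall>k\<in>{1..<c}. \<exists>S. finite S \<and> card S + (card X - Suc k) \<le> card (Y k) * card X \<and>
    D (Suc k) \<subseteq> span (S \<union> D (k + 2) \<union> ?K)"
  proof
    fix k assume "k \<in> {1..<c}"
    note Y' = Y[OF this]
    show "\<exists>S. finite S \<and> card S + (card X - Suc k) \<le> card (Y k) * card X \<and>
        D (Suc k) \<subseteq> span (S \<union> D (k + 2) \<union> ?K)"
      by (rule commutator_step_span[OF X R]) (use Y' in simp_all)
  qed
  then obtain S where S: "\<forall>k\<in>{1..<c}. finite (S k) \<and> card (S k) + (card X - Suc k) \<le> card (Y k) * card X \<and>
    D (Suc k) \<subseteq> span (S k \<union> D (k + 2) \<union> ?K)"
    by (rule bchoice[THEN exE])
  \<comment> \<open>\<open>S k\<close> accounts for \<open>D (Suc k)\<close> modulo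
    \<open>D (k + 2)\<close>, so the sets with index below \<open>j\<close> leave
    \<open>D (Suc j)\<close> as remainder.\<close>
  have "j \<le> c \<longrightarrow> D 1 \<subseteq> span (S0 \<union> (\<Union>k\<in>{1..<j}. S k) \<union> D (Suc j) \<union> ?K)" if "1 \<le> j" for j
    using that
  proof (induction j rule: dec_induct)
    case base
    show ?case using S0(3) by (simp add: numeral_2_eq_2)
  next
    case (step j)
    show ?case
    proof
      assume jc: "Suc j \<le> c"
      let ?V = "span (S0 \<union> (\<Union>k\<in>{1..<Suc j}. S k) \<union> D (Suc (Suc j)) \<union> ?K)"
      have "D (Suc j) \<subseteq> span (S j \<union> D (j + 2) \<union> ?K)" using S step.hyps jc by auto
      also have "\<dots> \<subseteq> ?V" by (rule span_mono) (use step.hyps in auto)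
      finally have "D (Suc j) \<subseteq> ?V" .
      moreover have "S0 \<union> (\<Union>k\<in>{1..<j}. S k) \<union> ?K \<subseteq> ?V"
        by (rule subset_trans[OF _ span_superset]) fastforce
      ultimately have "span (S0 \<union> (\<Union>k\<in>{1..<j}. S k) \<union> D (Suc j) \<union> ?K) \<subseteq> ?V"
        by (intro span_minimal[OF _ subspace_span]) blast
      then show "D 1 \<subseteq> ?V" using step.IH jc by simp
    qed
  qed
  then have "D 1 \<subseteq> span (S0 \<union> (\<Union>k\<in>{1..<c}. S k) \<union> D (Suc c) \<union> ?K)" using c(1) by blast
  also have "\<dots> \<subseteq> span (S0 \<union> (\<Union>k\<in>{1..<c}. S k) \<union> ?K)"
  proof (rule span_mono)
    have "D (Suc c) \<subseteq> ?K"
      unfolding D_Suc[of c] by (rule commutator_least[OF _ subspace_commutator])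
        (use c(2) brk_skew_mem_graded[OF R order_refl graded_whole] in blast)
    then show "S0 \<union> (\<Union>k\<in>{1..<c}. S k) \<union> D (Suc c) \<union> ?K \<subseteq> S0 \<union> (\<Union>k\<in>{1..<c}. S k) \<union> ?K" by blast
  qed
  finally have D: "D 1 \<subseteq> span ((S0 \<union> (\<Union>k\<in>{1..<c}. S k)) \<union> ?K)" .
  have "card (S0 \<union> (\<Union>k\<in>{1..<c}. S k)) \<le> card S0 + (\<Sum>k=1..<c. card (S k))"
    by (rule order_trans[OF card_Un_le]) (simp add: card_UN_le)
  moreover have "(\<Sum>k=1..<c. card (S k)) + (\<Sum>k=1..<c. card X - Suc k) \<le> (\<Sum>k=1..<c. card (Y k)) * card X"
    unfolding sum.distrib[symmetric] sum_distrib_right by (rule sum_mono) (use S in auto)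
  moreover have "finite (S0 \<union> (\<Union>k\<in>{1..<c}. S k))" using S0(1) S by auto
  ultimately show ?thesis using D S0(2) by (intro exI[of _ "S0 \<union> (\<Union>k\<in>{1..<c}. S k)"]) linarith
qed

end

section \<open>The epimorphism of a presentation and its kernel\<close>

locale super_epi = F: super_lie F + L: super_lie L
  for F :: "('k::field, 'f::ab_group_add) superalgebra"
    and L :: "('k, 'v::ab_group_add) superalgebra" +
  fixes p :: "'f \<Rightarrow> 'v"
  assumes hom: "super_hom F L p" and onto: "p ` whole F = whole L"
begin

definition ker :: "'f set" where
  "ker = {x \<in> whole F. p x = 0}"

lemma p_linear: "linear_map_on F F.H L p"
  using hom unfolding super_hom_def by (rule conjunct1)

lemma p_part_subset: "p ` part F a \<subseteq> part L a"
  using hom unfolding super_hom_def by (elim conjE allE)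

lemma p_brk: "x \<in> F.H \<Longrightarrow> y \<in> F.H \<Longrightarrow> p (brk F x y) = brk L (p x) (p y)"
  using hom unfolding super_hom_def by (elim conjE) blast

lemma p_add: "x \<in> F.H \<Longrightarrow> y \<in> F.H \<Longrightarrow> p (x + y) = p x + p y"
  using p_linear unfolding linear_map_on_def by (elim conjE) blast

lemma p_scale: "x \<in> F.H \<Longrightarrow> p (scl F t x) = scl L t (p x)"
  using p_linear unfolding linear_map_on_def by (elim conjE) blast

lemma p_diff:
  assumes "x \<in> F.H" "y \<in> F.H" shows "p (x - y) = p x - p y"
proof -
  have "x - y \<in> F.H" using assms by (rule F.subspace_diff[OF F.subspace_whole])
  then have "p (x - y + y) = p (x - y) + p y" using assms(2) by (rule p_add)
  then show ?thesis by simp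
qed

lemma p_0: "p 0 = 0"
  using p_diff[of 0 0] F.subspace_0[OF F.subspace_whole] by simp

lemma p_span: "A \<subseteq> F.H \<Longrightarrow> p ` F.span A = L.span (p ` A)"
  by (rule linear_map_on_span_image[OF p_linear F.vector_space_axioms L.vector_space_axioms F.subspace_whole])

lemma p_lower_central: "p ` F.D k = L.D k"
proof (induction k)
  case 0
  show ?case unfolding F.D_0 L.D_0 by (rule onto)
next
  case (Suc k)
  have DH: "F.D k \<subseteq> F.H" by (rule F.D_props)
  have "{brk F a b | a b. a \<in> F.D k \<and> b \<in> F.H} \<subseteq> F.H" using F.brk_whole DH by auto
  then have "p ` F.D (Suc k) = L.span (p ` {brk F a b | a b. a \<in> F.D k \<and> b \<in> F.H})"
    unfolding F.D_Suc commutator_def by (rule p_span)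
  also have "p ` {brk F a b | a b. a \<in> F.D k \<and> b \<in> F.H} = {p (brk F a b) | a b. a \<in> F.D k \<and> b \<in> F.H}"
    by blast
  also have "\<dots> = {brk L a b | a b. a \<in> p ` F.D k \<and> b \<in> p ` F.H}"
  proof (rule set_eqI, rule iffI)
    fix z assume "z \<in> {p (brk F a b) | a b. a \<in> F.D k \<and> b \<in> F.H}"
    then obtain a b where "z = p (brk F a b)" "a \<in> F.D k" "b \<in> F.H" by blast
    then have "z = brk L (p a) (p b)" "p a \<in> p ` F.D k" "p b \<in> p ` F.H" using p_brk DH by auto
    then show "z \<in> {brk L a b | a b. a \<in> p ` F.D k \<and> b \<in> p ` F.H}" by blast
  next
    fix z assume "z \<in> {brk L a b | a b. a \<in> p ` F.D k \<and> b \<in> p ` F.H}"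
    then obtain a b where "z = brk L (p a) (p b)" "a \<in> F.D k" "b \<in> F.H" by blast
    then have "z = p (brk F a b)" "a \<in> F.D k" "b \<in> F.H" using p_brk DH by auto
    then show "z \<in> {p (brk F a b) | a b. a \<in> F.D k \<and> b \<in> F.H}" by blast
  qed
  also have "L.span \<dots> = L.D (Suc k)" unfolding L.D_Suc commutator_def Suc onto ..
  finally show ?case .
qed

lemma whole_decomp:
  assumes "x \<in> F.H"
  obtains x0 x1 where "x = x0 + x1" "x0 \<in> part F 0" "x1 \<in> part F 1"
  using assms unfolding whole_def by blast

text \<open>The component of the right degree of any preimage is itself a preimage, since
  decompositions in \<open>L\<close> are unique. This provides homogeneous lifts of homogeneous
  elements.\<close>

lemma p_part: "p ` part F a = part L a"
proof (rule subset_antisym[OF p_part_subset], rule subsetI)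
  fix y assume y: "y \<in> part L a"
  then have "y \<in> p ` F.H" unfolding onto using L.part_subset_whole by blast
  then obtain x where x: "x \<in> F.H" "p x = y" by blast
  obtain x0 x1 where x01: "x = x0 + x1" "x0 \<in> part F 0" "x1 \<in> part F 1"
    using x(1) by (rule whole_decomp)
  note H = subsetD[OF F.part_subset_whole x01(2)] subsetD[OF F.part_subset_whole x01(3)]
  have px: "p x0 + p x1 = y" using x(2) p_add[OF H] x01(1) by simp
  have in01: "p x0 \<in> part L 0" "p x1 \<in> part L 1"
    using x01(2,3) p_part_subset[of 0] p_part_subset[of 1] by blast+
  consider "a = 0" | "a = 1" by (cases a) auto
  then show "y \<in> p ` part F a"
  proof cases
    case 1
    have "p x0 - y = 0"
    proof (rule L.whole_decomp_unique(1))
      show "p x0 - y \<in> part L 0"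
        using in01(1) y unfolding 1 by (rule L.subspace_diff[OF L.subspace_part])
      show "p x1 \<in> part L 1" by (rule in01)
      show "p x0 - y + p x1 = 0" unfolding px[symmetric] by simp
    qed
    then have "y = p x0" by simp
    then show ?thesis using x01(2) unfolding 1 by (rule image_eqI)
  next
    case 2
    have "p x1 - y = 0"
    proof (rule L.whole_decomp_unique(2))
      show "p x1 - y \<in> part L 1"
        using in01(2) y unfolding 2 by (rule L.subspace_diff[OF L.subspace_part])
      show "p x0 \<in> part L 0" by (rule in01)
      show "p x0 + (p x1 - y) = 0" unfolding px[symmetric] by simp
    qed
    then have "y = p x1" by simp
    then show ?thesis using x01(3) unfolding 2 by (rule image_eqI)
  qed
qed

lemma ker_subset: "ker \<subseteq> F.H"
  unfolding ker_def by blast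

lemma subspace_ker: "F.subspace ker"
  unfolding F.subspace_def ker_def
  using p_0 p_add p_scale F.subspace_whole[unfolded F.subspace_def] by simp

lemma ker_ideal: "commutator F F.H ker \<subseteq> ker"
proof (rule F.commutator_least)
  fix a b assume "a \<in> F.H" "b \<in> ker"
  moreover have "p a \<in> L.H" using \<open>a \<in> F.H\<close> onto by blast
  ultimately show "brk F a b \<in> ker"
    unfolding ker_def using F.brk_whole p_brk L.brk_0 by simp
qed (rule subspace_ker)

text \<open>As \<open>p\<close> preserves degrees, the components of a kernel element map to an even
  and an odd vector with sum 0, so both lie in the kernel.\<close>

lemma ker_graded: "F.graded ker"
  unfolding F.graded_def
proof
  fix x assume "x \<in> ker"
  then have x: "x \<in> F.H" "p x = 0" unfolding ker_def by auto
  obtain x0 x1 where x01: "x = x0 + x1" "x0 \<in> part F 0" "x1 \<in> part F 1"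
    using x(1) by (rule whole_decomp)
  note H = subsetD[OF F.part_subset_whole x01(2)] subsetD[OF F.part_subset_whole x01(3)]
  have px: "p x0 + p x1 = 0" using x(2) p_add[OF H] x01(1) by simp
  have in01: "p x0 \<in> part L 0" "p x1 \<in> part L 1"
    using x01(2,3) p_part_subset[of 0] p_part_subset[of 1] by blast+
  have "x0 \<in> ker" "x1 \<in> ker"
    unfolding ker_def using H L.whole_decomp_unique[OF in01 px] by auto
  then show "x \<in> F.span (ker \<inter> F.homog)"
    unfolding x01(1) using x01(2,3) by (intro F.span_add F.span_base) auto
qed

section \<open>Lifting bases to the presentation and bounding the multiplier\<close>

lemma span_lift:
  assumes A: "A \<subseteq> F.H" and x: "x \<in> F.H" "p x \<in> L.span (p ` A)"
  shows "x \<in> F.span (A \<union> ker)"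
proof -
  obtain y where y: "y \<in> F.span A" "p x = p y"
    using x(2) unfolding p_span[OF A, symmetric] by blast
  have yH: "y \<in> F.H" using y(1) F.span_minimal[OF A F.subspace_whole] by blast
  have "x - y \<in> ker"
    unfolding ker_def using p_diff[OF x(1) yH] y(2) F.subspace_diff[OF F.subspace_whole x(1) yH] by simp
  then have "x - y \<in> F.span (A \<union> ker)" by (intro F.span_base) blast
  moreover have "y \<in> F.span (A \<union> ker)" using y(1) F.span_mono[of A "A \<union> ker"] by blast
  ultimately have "(x - y) + y \<in> F.span (A \<union> ker)" by (rule F.span_add)
  then show ?thesis by simp
qed

lemma lift_finite:
  assumes "C \<subseteq> p ` A" "finite C"
  obtains X where "X \<subseteq> A" "finite X" "p ` X = C" "card X = card C"
proof -
  obtain X where X: "X \<subseteq> A" "inj_on p X" "C = p ` X"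
    using assms(1) unfolding subset_image_inj by blast
  with assms(2) show ?thesis by (intro that[of X]) (auto simp: card_image finite_image_iff)
qed

text \<open>Lifts of \<open>I\<close> together with lifts of a basis of \<open>L.D 1\<close> are
  independent modulo \<open>K\<close>: \<open>p\<close> detects the second family and kills the
  first, after which \<open>q\<close> detects the first. \<open>I\<close> is an arbitrary finite
  independent set because \<open>M\<close> is not yet known to be finite-dimensional.\<close>

lemma multiplier_card_bound:
  fixes M :: "('k, 'm::ab_group_add) superspace"
  assumes S: "finite S" "F.D 1 \<subseteq> F.span (S \<union> K)" and K: "F.subspace K"
    and fin: "finite B" "L.D 1 \<subseteq> L.span B"
    and M: "vector_space (scl M)"
    and q: "linear_map_on F (F.D 1 \<inter> ker) M q" "{x \<in> F.D 1 \<inter> ker. q x = 0} = K"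
    and I: "finite I" "I \<subseteq> q ` (F.D 1 \<inter> ker)" "\<not> module.dependent (scl M) I"
  shows "card I + L.dim (L.D 1) \<le> card S"
proof -
  interpret M: vector_space "scl M" by (rule M)
  obtain BL where BL: "BL \<subseteq> L.D 1" "L.independent BL" "L.D 1 \<subseteq> L.span BL" "card BL = L.dim (L.D 1)"
    by (rule L.basis_exists)
  have fBL: "finite BL"
    using L.independent_span_bound[OF fin(1) BL(2) subset_trans[OF BL(1) fin(2)]] by (rule conjunct1)
  have DH: "F.D 1 \<subseteq> F.H" by (rule F.D_props)
  have W: "F.subspace (F.D 1 \<inter> ker)"
    by (rule F.subspace_inter[OF F.D_props(2) subspace_ker])
  define w where "w = inv_into (F.D 1 \<inter> ker) q"
  define v where "v = inv_into (F.D 1) p"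
  have w: "w b \<in> F.D 1 \<inter> ker" "q (w b) = b" if "b \<in> I" for b
  proof -
    have b: "b \<in> q ` (F.D 1 \<inter> ker)" using that I(2) by (rule subsetD[rotated])
    show "w b \<in> F.D 1 \<inter> ker" "q (w b) = b"
      unfolding w_def by (rule inv_into_into[OF b], rule f_inv_into_f[OF b])
  qed
  have v: "v b \<in> F.D 1" "p (v b) = b" if "b \<in> BL" for b
  proof -
    have b: "b \<in> p ` F.D 1" unfolding p_lower_central using that BL(1) by (rule subsetD[rotated])
    show "v b \<in> F.D 1" "p (v b) = b"
      unfolding v_def by (rule inv_into_into[OF b], rule f_inv_into_f[OF b])
  qed
  define f where "f = case_sum w v"
  have "card (I <+> BL) \<le> card S"
  proof (rule F.card_le_of_independent_mod[OF K S(1)])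
    show "finite (I <+> BL)" using I(1) fBL by simp
    show "f i \<in> F.span (S \<union> K)" if "i \<in> I <+> BL" for i
    proof -
      have "f i \<in> F.D 1" using that w(1) v(1) unfolding f_def by auto
      then show ?thesis using S(2) by blast
    qed
    fix c assume "(\<Sum>i\<in>I <+> BL. scl F (c i) (f i)) \<in> K"
    then have cK: "(\<Sum>b\<in>I. scl F (c (Inl b)) (w b)) + (\<Sum>b\<in>BL. scl F (c (Inr b)) (v b)) \<in> K"
      (is "?w + ?v \<in> K") using I(1) fBL by (simp add: sum.Plus f_def o_def)
    have ws: "?w \<in> F.D 1 \<inter> ker \<and> q ?w = (\<Sum>b\<in>I. scl M (c (Inl b)) (q (w b)))"
      by (rule linear_map_on_sum[OF q(1) F.vector_space_axioms M W I(1)]) (rule w(1))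
    have vs: "?v \<in> F.H \<and> p ?v = (\<Sum>b\<in>BL. scl L (c (Inr b)) (p (v b)))"
      by (rule linear_map_on_sum[OF p_linear F.vector_space_axioms L.vector_space_axioms F.subspace_whole fBL])
        (use v(1) DH in blast)
    \<comment> \<open>Applying \<open>p\<close> removes \<open>?w\<close> and leaves a linear
      relation among the basis \<open>BL\<close>.\<close>
    have "?w + ?v \<in> ker" using cK q(2) by blast
    moreover have "?w \<in> F.H" "p ?w = 0" using ws unfolding ker_def by auto
    ultimately have "p ?v = 0" using p_add[of ?w ?v] vs unfolding ker_def by simp
    moreover have "(\<Sum>b\<in>BL. scl L (c (Inr b)) (p (v b))) = (\<Sum>b\<in>BL. scl L (c (Inr b)) b)"
      by (rule sum.cong) (simp_all add: v(2))
    ultimately have "(\<Sum>b\<in>BL. scl L (c (Inr b)) b) = 0" using vs by simp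
    then have cr: "c (Inr b) = 0" if "b \<in> BL" for b
      using L.independentD[OF BL(2) fBL order_refl, of "\<lambda>b. c (Inr b)" b] that by blast
    then have "?v = 0" by simp
    \<comment> \<open>With \<open>?v = 0\<close>, the sum \<open>?w\<close> itself lies in
      \<open>K\<close>, the kernel of \<open>q\<close>.\<close>
    then have "q ?w = 0" using cK q(2) by auto
    moreover have "(\<Sum>b\<in>I. scl M (c (Inl b)) (q (w b))) = (\<Sum>b\<in>I. scl M (c (Inl b)) b)"
      by (rule sum.cong) (simp_all add: w(2))
    ultimately have "(\<Sum>b\<in>I. scl M (c (Inl b)) b) = 0" using ws by simp
    then have "c (Inl b) = 0" if "b \<in> I" for b
      using M.independentD[OF I(3) I(1) order_refl, of "\<lambda>b. c (Inl b)" b] that by blast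
    with cr show "\<forall>i\<in>I <+> BL. c i = 0" by (auto simp only: Plus_def)
  qed
  then show ?thesis using I(1) fBL BL(4) by (simp add: card_Plus)
qed

text \<open>Working inside one degree makes the lifted basis of \<open>L / L.D 1\<close> homogeneous
  and yields the numbers of even and odd generators separately.\<close>

lemma exists_lifted_part_basis:
  assumes fin: "finite B" "L.H \<subseteq> L.span B"
  obtains X where "X \<subseteq> part F a" "finite X" "0 \<notin> X"
    "card X + L.dim (L.D 1 \<inter> part L a) = L.dim (part L a)"
    "part L a \<subseteq> L.span (p ` X \<union> L.D 1)"
proof -
  have sub: "L.D 1 \<inter> part L a \<subseteq> part L a" by (rule Int_lower2)
  have ss: "L.subspace (L.D 1 \<inter> part L a)"
    by (rule L.subspace_inter[OF L.D_props(2) L.subspace_part])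
  have sp: "part L a \<subseteq> L.span (part L a \<union> L.D 1 \<inter> part L a)"
    by (rule subset_trans[OF Un_upper1 L.span_superset])
  have pB: "part L a \<subseteq> L.span B" by (rule subset_trans[OF L.part_subset_whole fin(2)])
  obtain C where C: "C \<subseteq> part L a" "finite C" "0 \<notin> C"
    "card C + L.dim (L.D 1 \<inter> part L a) = L.dim (part L a)"
    "part L a \<subseteq> L.span (C \<union> L.D 1 \<inter> part L a)"
    by (rule L.relative_basis_subset[OF sub ss order_refl sp fin(1) pB])
  obtain X where X: "X \<subseteq> part F a" "finite X" "p ` X = C" "card X = card C"
    by (rule lift_finite[OF C(1)[folded p_part] C(2)])
  show ?thesis
  proof (rule that[OF X(1,2)])
    show "0 \<notin> X" using C(3) unfolding X(3)[symmetric] by (metis image_eqI p_0)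
    show "card X + L.dim (L.D 1 \<inter> part L a) = L.dim (part L a)" unfolding X(4) by (rule C(4))
    have "L.span (C \<union> L.D 1 \<inter> part L a) \<subseteq> L.span (p ` X \<union> L.D 1)"
      unfolding X(3) by (rule L.span_mono) auto
    then show "part L a \<subseteq> L.span (p ` X \<union> L.D 1)" using C(5) by (rule subset_trans[rotated])
  qed
qed

lemma exists_generators:
  assumes fin: "finite B" "L.H \<subseteq> L.span B"
  obtains X where "finite X" "X \<subseteq> F.homog" "F.H \<subseteq> F.span (X \<union> F.D 1 \<union> ker)"
    "card X = card (X \<inter> part F 0) + card (X \<inter> part F 1)"
    "\<And>a. card (X \<inter> part F a) + L.dim (L.D 1 \<inter> part L a) = L.dim (part L a)"
proof -
  obtain X0 where X0: "X0 \<subseteq> part F 0" "finite X0" "0 \<notin> X0"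
    "card X0 + L.dim (L.D 1 \<inter> part L 0) = L.dim (part L 0)"
    "part L 0 \<subseteq> L.span (p ` X0 \<union> L.D 1)"
    by (rule exists_lifted_part_basis[OF fin])
  obtain X1 where X1: "X1 \<subseteq> part F 1" "finite X1" "0 \<notin> X1"
    "card X1 + L.dim (L.D 1 \<inter> part L 1) = L.dim (part L 1)"
    "part L 1 \<subseteq> L.span (p ` X1 \<union> L.D 1)"
    by (rule exists_lifted_part_basis[OF fin])
  define X where "X = X0 \<union> X1"
  \<comment> \<open>Since 0 was excluded from \<open>X0\<close> and \<open>X1\<close>, each
    generator has a single degree and the two counts do not overlap.\<close>
  have "X1 \<inter> part F 0 \<subseteq> {0}" "X0 \<inter> part F 1 \<subseteq> {0}"
    using F.part_disjoint Int_mono[OF X1(1) order_refl, of "part F 0"] Int_mono[OF X0(1) order_refl, of "part F 1"]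
    by (simp_all add: Int_commute)
  then have d: "X1 \<inter> part F 0 = {}" "X0 \<inter> part F 1 = {}" using X0(3) X1(3) by auto
  have X_part: "X \<inter> part F 0 = X0" "X \<inter> part F 1 = X1"
    unfolding X_def using d X0(1) X1(1) by auto
  have homog: "X \<subseteq> F.homog" unfolding X_def using X0(1) X1(1) by auto
  have XH: "X \<union> F.D 1 \<subseteq> F.H"
    using subset_trans[OF homog F.homog_whole] F.D_props(1) by (rule Un_least)
  have img: "p ` (X \<union> F.D 1) = p ` X0 \<union> p ` X1 \<union> L.D 1"
    unfolding X_def image_Un p_lower_central by simp
  have "L.H \<subseteq> L.span (p ` (X \<union> F.D 1))"
    unfolding L.whole_eq_span img
  proof (rule L.span_minimal[OF _ L.subspace_span], rule Un_least)
    show "part L 0 \<subseteq> L.span (p ` X0 \<union> p ` X1 \<union> L.D 1)"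
      by (rule subset_trans[OF X0(5) L.span_mono]) auto
    show "part L 1 \<subseteq> L.span (p ` X0 \<union> p ` X1 \<union> L.D 1)"
      by (rule subset_trans[OF X1(5) L.span_mono]) auto
  qed
  then have sp: "F.H \<subseteq> F.span (X \<union> F.D 1 \<union> ker)"
    using onto span_lift[OF XH] by blast
  show ?thesis
  proof (rule that[OF _ homog sp])
    show "finite X" unfolding X_def using X0(2) X1(2) by simp
    show "card X = card (X \<inter> part F 0) + card (X \<inter> part F 1)"
      unfolding X_part unfolding X_def
      by (rule card_Un_disjoint[OF X0(2) X1(2)]) (use d X1(1) in auto)
    show "card (X \<inter> part F a) + L.dim (L.D 1 \<inter> part L a) = L.dim (part L a)" for a
      using X0(4) X1(4) X_part by (cases a) simp_all
  qed
qed

text \<open>Words span each term modulo the next and the kernel, so their images contain a basis of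
  \<open>L.D k\<close> modulo \<open>L.D (Suc k)\<close>. Taking words as representatives is what
  makes the saving in \<open>commutator_step_span\<close> available.\<close>

lemma exists_word_basis:
  assumes fin: "finite B" "L.H \<subseteq> L.span B"
    and X: "X \<subseteq> F.homog" "F.H \<subseteq> F.span (X \<union> F.D 1 \<union> ker)"
  obtains Y where "finite Y" "Y \<subseteq> F.words X k" "card Y + L.dim (L.D (Suc k)) = L.dim (L.D k)"
    "F.D k \<subseteq> F.span (Y \<union> F.D (Suc k) \<union> ker)"
proof -
  let ?W = "F.words X k"
  have WD: "?W \<subseteq> F.D k" by (rule F.words_D[OF X(1)])
  have WH: "?W \<union> F.D (Suc k) \<subseteq> F.H" using subset_trans[OF WD F.D_props(1)] F.D_props(1) by (rule Un_least)
  have pW: "p ` ?W \<subseteq> L.D k" using image_mono[OF WD, of p] unfolding p_lower_central .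
  have "L.D k \<subseteq> p ` F.span (?W \<union> F.D (Suc k) \<union> ker)"
    using image_mono[OF F.words_span[OF X ker_subset ker_graded ker_ideal], of p k]
    unfolding p_lower_central .
  also have "\<dots> = L.span (p ` (?W \<union> F.D (Suc k) \<union> ker))"
    by (rule p_span) (use WH ker_subset in blast)
  also have "\<dots> \<subseteq> L.span (p ` ?W \<union> L.D (Suc k))"
  proof (rule L.span_minimal[OF _ L.subspace_span])
    have "p ` ker \<subseteq> {0}" unfolding ker_def by auto
    moreover have "0 \<in> L.span (p ` ?W \<union> L.D (Suc k))" by (rule L.span_zero)
    ultimately show "p ` (?W \<union> F.D (Suc k) \<union> ker) \<subseteq> L.span (p ` ?W \<union> L.D (Suc k))"
      using L.span_superset[of "p ` ?W \<union> L.D (Suc k)"] unfolding image_Un p_lower_central by auto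
  qed
  finally have sp: "L.D k \<subseteq> L.span (p ` ?W \<union> L.D (Suc k))" .
  obtain C where C: "C \<subseteq> p ` ?W" "finite C" "0 \<notin> C" "card C + L.dim (L.D (Suc k)) = L.dim (L.D k)"
    "L.D k \<subseteq> L.span (C \<union> L.D (Suc k))"
    by (rule L.relative_basis_subset[OF L.D_decreasing L.D_props(2) pW sp fin(1)
          subset_trans[OF L.D_props(1) fin(2)]])
  obtain Y where Y: "Y \<subseteq> ?W" "finite Y" "p ` Y = C" "card Y = card C"
    by (rule lift_finite[OF C(1,2)])
  show ?thesis
  proof (rule that[OF Y(2,1)])
    show "card Y + L.dim (L.D (Suc k)) = L.dim (L.D k)" unfolding Y(4) by (rule C(4))
    show "F.D k \<subseteq> F.span (Y \<union> F.D (Suc k) \<union> ker)"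
    proof
      fix x assume x: "x \<in> F.D k"
      show "x \<in> F.span (Y \<union> F.D (Suc k) \<union> ker)"
      proof (rule span_lift)
        show "Y \<union> F.D (Suc k) \<subseteq> F.H" using Y(1) WH by blast
        show "x \<in> F.H" using x F.D_props(1) by blast
        have "p x \<in> L.D k" using x unfolding p_lower_central[symmetric] by (rule imageI)
        then show "p x \<in> L.span (p ` (Y \<union> F.D (Suc k)))"
          unfolding image_Un p_lower_central Y(3) using C(5) by (rule subsetD[rotated])
      qed
    qed
  qed
qed

text \<open>Combines the lower bound from independence modulo [F, R] with the size of the spanning
  set. Here \<open>d0\<close> and \<open>d1\<close> count even and odd generators; \<open>d1\<close>
  also occurs alone because of the odd squares.\<close>

lemma schur_multiplier_card_bound:
  fixes M :: "('k, 'm::ab_group_add) superspace"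
  assumes char: "CHAR('k) \<noteq> 2"
    and nil: "c \<ge> 1" "L.D c = {0}" "L.D (c - 1) \<noteq> {0}"
    and fin: "finite B" "L.H \<subseteq> L.span B"
    and M: "schur_multiplier F ker M"
  obtains d0 d1 where
    "d0 + L.dim (L.D 1 \<inter> part L 0) = L.dim (part L 0)"
    "d1 + L.dim (L.D 1 \<inter> part L 1) = L.dim (part L 1)"
    "\<And>I. finite I \<Longrightarrow> I \<subseteq> whole M \<Longrightarrow> \<not> module.dependent (scl M) I \<Longrightarrow>
      card I + L.dim (L.D 1) + (\<Sum>k=1..<c. d0 + d1 - Suc k)
        \<le> (d0 + d1 choose 2) + d1 + L.dim (L.D 1) * (d0 + d1)"
proof -
  obtain X where X: "finite X" "X \<subseteq> F.homog" "F.H \<subseteq> F.span (X \<union> F.D 1 \<union> ker)"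
    "card X = card (X \<inter> part F 0) + card (X \<inter> part F 1)"
    "\<And>a. card (X \<inter> part F a) + L.dim (L.D 1 \<inter> part L a) = L.dim (part L a)"
    using exists_generators[OF fin] by metis
  have "\<exists>Y. finite Y \<and> Y \<subseteq> F.words X k \<and> card Y + L.dim (L.D (Suc k)) = L.dim (L.D k) \<and>
    F.D k \<subseteq> F.span (Y \<union> F.D (Suc k) \<union> ker)" for k
    by (rule exists_word_basis[OF fin X(2,3), of k]) blast
  then obtain Y where Y: "\<And>k. finite (Y k)" "\<And>k. Y k \<subseteq> F.words X k"
    "\<And>k. card (Y k) + L.dim (L.D (Suc k)) = L.dim (L.D k)"
    "\<And>k. F.D k \<subseteq> F.span (Y k \<union> F.D (Suc k) \<union> ker)"
    by metis
  \<comment> \<open>An empty \<open>Y k\<close> would make \<open>L.D k\<close> equal to its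
    successor, hence stationary and 0, although \<open>L.D (c - 1)\<close> below it is
    nonzero.\<close>
  have Y_ne: "Y k \<noteq> {}" if "k \<in> {1..<c}" for k
  proof
    assume "Y k = {}"
    then have "F.D k \<subseteq> F.span (F.D (Suc k) \<union> ker)" using Y(4)[of k] by simp
    then have "L.D k \<subseteq> p ` F.span (F.D (Suc k) \<union> ker)"
      unfolding p_lower_central[symmetric] by (rule image_mono)
    also have "\<dots> = L.span (p ` (F.D (Suc k) \<union> ker))"
      by (rule p_span[OF Un_least[OF F.D_props(1) ker_subset]])
    also have "\<dots> \<subseteq> L.D (Suc k)"
    proof (rule L.span_minimal[OF _ L.D_props(2)])
      have "p ` ker \<subseteq> {0}" unfolding ker_def by auto
      then show "p ` (F.D (Suc k) \<union> ker) \<subseteq> L.D (Suc k)"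
        unfolding image_Un p_lower_central using L.subspace_0[OF L.D_props(2)] by auto
    qed
    finally have "L.D (Suc k) = L.D k" using L.D_decreasing by (intro subset_antisym)
    then have "L.D (k + (c - k)) = L.D k" by (rule L.D_stationary)
    then have "L.D k = {0}" using that nil(2) by simp
    moreover have "L.D (c - 1) \<subseteq> L.D k" by (rule L.D_antimono) (use that in auto)
    moreover have "0 \<in> L.D (c - 1)" by (rule L.subspace_0[OF L.D_props(2)])
    ultimately show False using nil(3) by auto
  qed
  have "F.D c \<subseteq> ker"
  proof
    fix x assume x: "x \<in> F.D c"
    then have "p x \<in> L.D c" unfolding p_lower_central[symmetric] by (rule imageI)
    then show "x \<in> ker" unfolding ker_def using nil(2) x F.D_props(1) by auto
  qed
  then obtain S where S: "finite S"
    "card S + (\<Sum>k=1..<c. card X - Suc k)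
      \<le> (card X choose 2) + card (X \<inter> part F 1) + (\<Sum>k=1..<c. card (Y k)) * card X"
    "F.D 1 \<subseteq> F.span (S \<union> commutator F F.H ker)"
    using F.derived_span_mod_central[OF char X(1-3) ker_subset ker_graded _ nil(1), of Y] Y Y_ne by metis
  \<comment> \<open>The sizes of the \<open>Y k\<close> telescope; since \<open>L.D c\<close> is 0,
    at \<open>j = c\<close> they add up to the dimension of \<open>L.D 1\<close>.\<close>
  have "j \<ge> 1 \<Longrightarrow> (\<Sum>k=1..<j. card (Y k)) + L.dim (L.D j) = L.dim (L.D 1)" for j
  proof (induction j rule: dec_induct)
    case (step j)
    then show ?case using Y(3)[of j] by simp
  qed simp
  from this[OF nil(1)] have sumY: "(\<Sum>k=1..<c. card (Y k)) = L.dim (L.D 1)"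
    unfolding nil(2) using L.dim_le_card[of "{0}" "{}"] by simp
  have D1: "commutator F F.H F.H = F.D 1" unfolding One_nat_def F.D_Suc F.D_0 ..
  obtain q where q: "linear_map_on F (F.D 1 \<inter> ker) M q" "q ` (F.D 1 \<inter> ker) = whole M"
    "{x \<in> F.D 1 \<inter> ker. q x = 0} = commutator F F.H ker"
    using M unfolding schur_multiplier_def Let_def D1 by (elim conjE exE) (rule that)
  have Mv: "vector_space (scl M)"
    using M unfolding schur_multiplier_def is_superspace_def by (elim conjE)
  show ?thesis
  proof (rule that[OF X(5)[of 0] X(5)[of 1]])
    fix I assume I: "finite I" "I \<subseteq> whole M" "\<not> module.dependent (scl M) I"
    have "card I + L.dim (L.D 1) \<le> card S"
      by (rule multiplier_card_bound[OF S(1,3) F.subspace_commutator fin(1)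
            subset_trans[OF L.D_props(1) fin(2)] Mv q(1,3) I(1) I(2)[folded q(2)] I(3)])
    then show "card I + L.dim (L.D 1)
        + (\<Sum>k=1..<c. card (X \<inter> part F 0) + card (X \<inter> part F 1) - Suc k)
      \<le> (card (X \<inter> part F 0) + card (X \<inter> part F 1) choose 2) + card (X \<inter> part F 1)
        + L.dim (L.D 1) * (card (X \<inter> part F 0) + card (X \<inter> part F 1))"
      using S(2) unfolding sumY X(4) by linarith
  qed
qed

end

section \<open>Numerical form of the bound\<close>

lemma real_choose_two: "real (n choose 2) = real n * (real n - 1) / 2"
  by (induction n) (simp_all add: numeral_2_eq_2 field_simps)

text \<open>With \<open>i = k + 1\<close>, the terms beyond \<open>min c d\<close> are exactly those
  that truncated subtraction turns into 0.\<close>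

lemma sum_truncated_difference:
  assumes "c \<ge> 1"
  shows "(\<Sum>i = 2..min (int c) (int d). real d - real_of_int i) = real (\<Sum>k=1..<c. d - Suc k)"
  using assms
proof (induction c rule: dec_induct)
  case base
  show ?case by simp
next
  case (step c)
  show ?case
  proof (cases "Suc c \<le> d")
    case True
    then have "{2..min (int (Suc c)) (int d)} = insert (int (Suc c)) {2..min (int c) (int d)}"
      using step.hyps by auto
    with step True show ?thesis by (simp add: of_nat_diff)
  next
    case False
    then have "min (int (Suc c)) (int d) = min (int c) (int d)" by auto
    with step False show ?thesis by simp
  qed
qed

text \<open>Finite-dimensionality is derived here: an infinite homogeneous basis would contain an
  independent set of \<open>Suc N\<close> elements.\<close>

lemma super_space_has_sdim:
  fixes M :: "('k::field, 'm::ab_group_add) superspace"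
  assumes M: "is_superspace M"
    and bound: "\<And>I. finite I \<Longrightarrow> I \<subseteq> whole M \<Longrightarrow> \<not> module.dependent (scl M) I \<Longrightarrow> card I \<le> N"
  shows "\<exists>p q. has_sdim M (whole M) p q \<and> p + q \<le> N"
proof -
  interpret super_space M by (unfold_locales) (rule M)
  obtain B0 where B0: "B0 \<subseteq> part M 0" "independent B0" "part M 0 \<subseteq> span B0" "card B0 = dim (part M 0)"
    by (rule basis_exists)
  obtain B1 where B1: "B1 \<subseteq> part M 1" "independent B1" "part M 1 \<subseteq> span B1" "card B1 = dim (part M 1)"
    by (rule basis_exists)
  note B = union_of_part_bases[OF B0(1) B1(1) B0(2) B1(2)]
  have sub: "B0 \<union> B1 \<subseteq> whole M"
    using subset_trans[OF B0(1) part_subset_whole] subset_trans[OF B1(1) part_subset_whole] by (rule Un_least)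
  have fin: "finite (B0 \<union> B1)"
  proof (rule ccontr)
    assume "infinite (B0 \<union> B1)"
    then obtain I where I: "finite I" "card I = Suc N" "I \<subseteq> B0 \<union> B1"
      using infinite_arbitrarily_large by blast
    have "card I \<le> N"
      by (rule bound[OF I(1) subset_trans[OF I(3) sub] independent_mono[OF B(1) I(3)]])
    then show False using I(2) by simp
  qed
  have "card B0 + card B1 \<le> N"
    using bound[OF fin sub B(1)] B(2) fin by (simp add: card_Un_disjoint)
  moreover have "whole M \<subseteq> span (B0 \<union> B1)"
    unfolding whole_eq_span
  proof (rule span_minimal[OF _ subspace_span], rule Un_least)
    show "part M 0 \<subseteq> span (B0 \<union> B1)" by (rule subset_trans[OF B0(3) span_mono]) auto
    show "part M 1 \<subseteq> span (B0 \<union> B1)" by (rule subset_trans[OF B1(3) span_mono]) auto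
  qed
  ultimately show ?thesis
    unfolding has_sdim_def using fin B0(4) B1(4) Int_absorb1[OF part_subset_whole] by auto
qed

theorem theorem3p3:
  fixes L :: "('k::field, 'v::ab_group_add) superalgebra"
    and F :: "('k, 'f::ab_group_add) superalgebra"
    and R :: "'f set"
    and M :: "('k, 'm::ab_group_add) superspace"
    and c m n r s :: nat
    and l :: int
  assumes "CHAR('k) \<noteq> 2" and "CHAR('k) \<noteq> 3"
    and "lie_superalgebra L"
    and "step_nilpotent L c"
    and "has_sdim L (whole L) m n"
    and "has_sdim L (lower_central L 2) r s"
    and "r + s \<ge> 1"
    and "free_presentation L F R"
    and "schur_multiplier F R M"
    and "l = min (int c) (int m + int n - int r - int s)"
  shows "\<exists>p q. has_sdim M (whole M) p q \<and>
           real p + real q \<le>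
             1 / 2 * ((real m + real n - real r - real s) * (real m + real n + real r + real s)
                      + (real n - real m - real r - 3 * real s))
             - (\<Sum>i = 2..l. real m + real n - real r - real s - real_of_int i)"
proof -
  obtain p where p: "super_hom F L p" "p ` whole F = whole L" "R = {x \<in> whole F. p x = 0}"
    and F: "lie_superalgebra F"
    using assms(8) unfolding free_presentation_def by (elim conjE exE) (rule that)
  interpret super_epi F L p
    by unfold_locales (rule F assms(3) p(1,2))+
  have R: "R = ker" unfolding ker_def by (rule p(3))
  obtain B where B: "finite B" "L.H \<subseteq> L.span B"
    using assms(5) unfolding has_sdim_def by (elim conjE exE) (rule that)
  have mn: "L.dim (part L 0) = m" "L.dim (part L 1) = n"
    using assms(5) unfolding has_sdim_def by (simp_all add: Int_absorb1[OF L.part_subset_whole])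
  have rs: "L.dim (L.D 1 \<inter> part L 0) = r" "L.dim (L.D 1 \<inter> part L 1) = s"
    using assms(6) unfolding has_sdim_def by (simp_all add: numeral_2_eq_2)
  have t: "L.dim (L.D 1) = r + s"
    unfolding rs[symmetric]
    by (rule L.dim_graded[OF L.D_props(2,3) B(1) subset_trans[OF L.D_props(1) B(2)]])
  have nil: "c \<ge> 1" "L.D c = {0}" "L.D (c - 1) \<noteq> {0}"
    using assms(4) unfolding step_nilpotent_def by simp_all
  obtain d0 d1 where d: "d0 + r = m" "d1 + s = n"
    and bound: "\<And>I. finite I \<Longrightarrow> I \<subseteq> whole M \<Longrightarrow> \<not> module.dependent (scl M) I \<Longrightarrow>
      card I + (r + s) + (\<Sum>k=1..<c. d0 + d1 - Suc k)
        \<le> (d0 + d1 choose 2) + d1 + (r + s) * (d0 + d1)"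
    using schur_multiplier_card_bound[OF assms(1) nil B assms(9)[unfolded R]] unfolding mn rs t by metis
  let ?S = "\<Sum>k=1..<c. d0 + d1 - Suc k"
  let ?N = "(d0 + d1 choose 2) + d1 + (r + s) * (d0 + d1)"
  have Msup: "is_superspace M" using assms(9) unfolding schur_multiplier_def by (rule conjunct1)
  have "card I \<le> ?N - (r + s) - ?S"
    if "finite I" "I \<subseteq> whole M" "\<not> module.dependent (scl M) I" for I
    using bound[OF that] by linarith
  then obtain a b where ab: "has_sdim M (whole M) a b" "a + b \<le> ?N - (r + s) - ?S"
    using super_space_has_sdim[OF Msup] by blast
  interpret M: super_space M by unfold_locales (rule Msup)
  \<comment> \<open>The bound for the empty set shows that the natural subtractions in
    \<open>ab(2)\<close> do not truncate, so the terms may be moved to the left-hand side.\<close>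
  have "card ({} :: 'm set) + (r + s) + ?S \<le> ?N"
    by (rule bound) (simp_all add: M.independent_empty)
  with ab(2) have "a + b + (r + s) + ?S \<le> ?N" by simp
  then have "real (a + b + (r + s) + ?S) \<le> real ?N" by (rule of_nat_mono)
  then have main: "real a + real b + real r + real s + real ?S
      \<le> real (d0 + d1) * (real (d0 + d1) - 1) / 2 + real d1 + (real r + real s) * real (d0 + d1)"
    by (simp only: of_nat_add of_nat_mult real_choose_two add.assoc)
  have d': "real m + real n - real r - real s = real (d0 + d1)" using d by auto
  have l: "l = min (int c) (int (d0 + d1))" using assms(10) d by auto
  \<comment> \<open>Substituting \<open>m = d0 + r\<close> and \<open>n = d1 + s\<close> turns the
    bracket into the spanning count: the linear term becomes
    \<open>(d1 - d0) / 2 - (r + s)\<close>.\<close>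
  have "real a + real b \<le> 1 / 2 * (real (d0 + d1) * (real m + real n + real r + real s)
      + (real n - real m - real r - 3 * real s)) - real ?S"
    using main unfolding d[symmetric] by (simp add: field_simps)
  then show ?thesis
    unfolding d' l sum_truncated_difference[OF nil(1)] using ab(1) by blast
qed

end
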